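(* Let $\eta_1,\eta_2,\ldots$ be independent (not necessarily identically distributed) zero-mean real random variables such that $|\eta_i|\le 1$ almost surely for all $i$. Let $a_1,a_2,\dots$ be real numbers such that $a_1^2+a_2^2+\dots=1$, and let $S:=a_1\eta_1+a_2\eta_2+\cdots$. Let $Z$ be a standard normal random variable and $\lambda:=\ln\frac{2e^3}{9}$. Then for all $x>0$, $$\mathsf{P}(S\ge x)\le \min\big(e^{-x^2/2},\ \mathsf{P}(Z\ge x-\lambda/x)\big)$$ and $$\mathsf{P}(|S|\ge x)\le \min\big(\tfrac{1}{x^2},\ \mathsf{P}(|Z|\ge x-\lambda/x)\big).$$
   Context: The numerical value of the constant is $\lambda=1.495\ldots$. The series defining $S$ is an almost surely convergent sum of independent random variables. When $x-\lambda/x\le 0$, $\mathsf{P}(|Z|\ge x-\lambda/x)=1$. *)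

theory Defs
  imports "HOL-Probability.Probability"
begin

definition lam :: real where
  "lam = ln (2 * exp 1 ^ 3 / 9)"

end

theory Submission imports Defs begin

text \<open>
  Write \<open>q\<close> for the Gaussian tail and \<open>c = exp lam = 2e\<^sup>3/9\<close>. For \<open>f t = (t - u)\<^sub>+\<^sup>3\<close> and for
  \<open>f t = (t + s)\<^sup>2\<close>, each summand can be replaced by a centred normal variable of variance
  \<open>a\<^sub>i\<^sup>2\<close>: convexity reduces it to a Rademacher variable, and convexity of \<open>f''\<close> lets Jensen in
  \<open>Z\<^sup>2\<close> pass to the normal one. Hence \<open>E f(S) \<le> E f(Z)\<close>, by Fatou, once the series converges
  almost surely, which follows from Kolmogorov's maximal inequality.

  Markov's inequality gives \<open>P(S \<ge> x) \<le> E(Z - u)\<^sub>+\<^sup>3 / (x - u)\<^sup>3\<close>. With \<open>u = x - 3/x\<close> the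
  inequality \<open>1 + y \<le> e\<^sup>y\<close> yields \<open>exp (-x\<^sup>2/2)\<close>. With \<open>u = x - 3/k\<close>, where \<open>k\<close> is the
  hazard rate at \<open>x\<close>, log-concavity \<open>q t \<le> q x * exp (-k (t - x))\<close> yields \<open>c q(x)\<close>. For
  \<open>x\<^sup>2 \<ge> lam\<close> one has \<open>c q(x) \<le> q(x - lam/x)\<close>: the difference is nonnegative at
  \<open>x\<^sup>2 = lam\<close> (a numerical fact with a margin of about one percent), tends to 0 at infinity,
  and first increases, then decreases. For \<open>x\<^sup>2 \<le> lam\<close> Cantelli's bound \<open>1/(1 + x\<^sup>2)\<close> is
  already below \<open>q(x - lam/x)\<close>.
\<close>

section \<open>The Gaussian tail\<close>

abbreviation std_gauss :: "real measure"
  where "std_gauss \<equiv> density lborel (\<lambda>t. ennreal (std_normal_density t))"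

lemma prob_space_std_gauss: "prob_space std_gauss"
  by (rule prob_space_normal_density) simp

interpretation std_gauss: prob_space std_gauss
  by (rule prob_space_std_gauss)

definition gauss_tail :: "real \<Rightarrow> real"
  where "gauss_tail y = measure std_gauss {y..}"

lemma std_normal_density_pos [simp]: "0 < std_normal_density t"
  by (simp add: normal_density_pos)

lemma gauss_tail_nonneg: "0 \<le> gauss_tail y"
  by (simp add: gauss_tail_def)

lemma emeasure_std_gauss_Ici: "emeasure std_gauss {y..} = ennreal (gauss_tail y)"
  by (simp add: gauss_tail_def std_gauss.emeasure_eq_measure)

lemma isCont_std_normal_density: "isCont std_normal_density t"
  unfolding std_normal_density_def by (intro continuous_intros) auto

lemma DERIV_std_normal_density [derivative_intros]:
  assumes "(g has_real_derivative g') (at x within A)"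
  shows "((\<lambda>x. std_normal_density (g x)) has_real_derivative - g x * std_normal_density (g x) * g')
    (at x within A)"
proof -
  have "DERIV (\<lambda>t. c * exp (- t\<^sup>2 / 2)) t :> - t * (c * exp (- t\<^sup>2 / 2))" for c t :: real
    by (auto intro!: derivative_eq_intros)
  from this[of "1 / sqrt (2 * pi)"] DERIV_chain2[OF _ assms]
  show ?thesis unfolding std_normal_density_def by blast
qed

lemma distr_std_gauss_scale:
  assumes "a \<noteq> 0"
  shows "distr std_gauss borel (\<lambda>t. a * t) = density lborel (\<lambda>t. ennreal (normal_density 0 \<bar>a\<bar> t))"
proof -
  have "distr std_gauss lborel (\<lambda>t. t) = distr std_gauss std_gauss (\<lambda>t. t)"
    by (rule distr_cong) auto
  then have "distributed std_gauss lborel (\<lambda>t. t) std_normal_density"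
    by (simp add: distributed_def)
  from std_gauss.normal_density_affine[OF this, of a 0] assms
  have "distributed std_gauss lborel (\<lambda>t. a * t) (normal_density 0 \<bar>a\<bar>)" by simp
  from distributed_distr_eq_density[OF this]
  have "distr std_gauss lborel (\<lambda>t. a * t) = density lborel (\<lambda>t. ennreal (normal_density 0 \<bar>a\<bar> t))" .
  moreover have "distr std_gauss borel (\<lambda>t. a * t) = distr std_gauss lborel (\<lambda>t. a * t)"
    by (intro distr_cong) auto
  ultimately show ?thesis by simp
qed

lemma distr_std_gauss_uminus: "distr std_gauss borel uminus = std_gauss"
  using distr_std_gauss_scale[of "-1"] by simp

lemma nn_integral_std_gauss_uminus:
  assumes [measurable]: "f \<in> borel_measurable borel"
  shows "(\<integral>\<^sup>+t. f (- t) \<partial>std_gauss) = (\<integral>\<^sup>+t. f t \<partial>std_gauss)"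
  by (subst (2) distr_std_gauss_uminus[symmetric]) (simp add: nn_integral_distr)

lemma gauss_tail_diff:
  assumes "a \<le> y"
  shows "gauss_tail y = gauss_tail a - integral {a..y} std_normal_density"
proof -
  have I: "(std_normal_density has_integral integral {a..y} std_normal_density) {a..y}"
    by (intro integrable_integral integrable_continuous_interval)
       (auto intro!: continuous_at_imp_continuous_on isCont_std_normal_density)
  have "emeasure std_gauss {a..<y} = (\<integral>\<^sup>+t. ennreal (std_normal_density t) * indicator {a..<y} t \<partial>lborel)"
    by (simp add: emeasure_density)
  also have "\<dots> = (\<integral>\<^sup>+t. ennreal (std_normal_density t) * indicator {a..y} t \<partial>lborel)"
    using AE_lborel_singleton[of y] by (intro nn_integral_cong_AE) (auto split: split_indicator)
  also have "\<dots> = ennreal (integral {a..y} std_normal_density)"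
    by (intro nn_integral_has_integral_lebesgue' I) auto
  finally have *: "measure std_gauss {a..<y} = integral {a..y} std_normal_density"
    by (simp add: measure_def integral_nonneg[OF has_integral_integrable[OF I]])
  have "measure std_gauss ({a..<y} \<union> {y..}) = measure std_gauss {a..<y} + measure std_gauss {y..}"
    by (rule std_gauss.finite_measure_Union) auto
  moreover have "{a..<y} \<union> {y..} = {a..}" using assms by auto
  ultimately have "measure std_gauss {a..} = measure std_gauss {a..<y} + measure std_gauss {y..}"
    by simp
  then show ?thesis unfolding gauss_tail_def using * by simp
qed

lemma DERIV_gauss_tail [derivative_intros]:
  assumes "(g has_real_derivative g') (at y within A)"
  shows "((\<lambda>y. gauss_tail (g y)) has_real_derivative - std_normal_density (g y) * g') (at y within A)"
proof -
  have "DERIV gauss_tail x :> - std_normal_density x" for x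
  proof -
    have "((\<lambda>u. integral {x-1..u} std_normal_density) has_real_derivative std_normal_density x) (at x within {x-1..x+1})"
      by (intro integral_has_real_derivative)
       (auto intro!: continuous_at_imp_continuous_on isCont_std_normal_density)
    then have "DERIV (\<lambda>u. integral {x-1..u} std_normal_density) x :> std_normal_density x"
      using at_within_Icc_at[of "x-1" x "x+1"] by simp
    then have "DERIV (\<lambda>u. gauss_tail (x-1) - integral {x-1..u} std_normal_density) x :> - std_normal_density x"
      by (auto intro!: derivative_eq_intros)
    then show ?thesis
      by (rule DERIV_cong_ev[OF refl _ refl, THEN iffD1, rotated])
         (rule eventually_nhds_in_open[of "{x-1<..}", THEN eventually_mono],
           auto intro!: gauss_tail_diff[symmetric])
  qed
  from DERIV_chain2[OF this assms] show ?thesis .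
qed

lemma gauss_tail_tendsto_0: "(gauss_tail \<longlongrightarrow> 0) at_top"
proof -
  have "(\<lambda>n. measure std_gauss {real n..}) \<longlonglongrightarrow> measure std_gauss (\<Inter>n. {real n..})"
    by (intro std_gauss.finite_Lim_measure_decseq) (auto simp: decseq_def)
  also have "(\<Inter>n. {real n..}) = {}"
    by (auto simp: not_le) (metis reals_Archimedean2 not_le)
  finally have lim: "(\<lambda>n. gauss_tail (real n)) \<longlonglongrightarrow> 0" by (simp add: gauss_tail_def)
  have mono: "gauss_tail y \<le> gauss_tail x" if "x \<le> y" for x y
    unfolding gauss_tail_def using that by (intro std_gauss.finite_measure_mono) auto
  show ?thesis
  proof (rule order_tendstoI)
    fix e :: real assume "e < 0"
    then show "\<forall>\<^sub>F y in at_top. e < gauss_tail y"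
      using gauss_tail_nonneg less_le_trans by (intro always_eventually) blast
  next
    fix e :: real assume "0 < e"
    with lim have "\<forall>\<^sub>F n in sequentially. gauss_tail (real n) < e"
      by (rule order_tendstoD)
    then obtain n where "gauss_tail (real n) < e"
      by (meson eventually_happens' sequentially_bot)
    then show "\<forall>\<^sub>F y in at_top. gauss_tail y < e"
      using mono by (auto simp: eventually_at_top_linorder intro!: exI[of _ "real n"] intro: le_less_trans)
  qed
qed

lemma gauss_tail_antimono: "x \<le> y \<Longrightarrow> gauss_tail y \<le> gauss_tail x"
  unfolding gauss_tail_def by (intro std_gauss.finite_measure_mono) auto

lemma gauss_tail_strict: "x < y \<Longrightarrow> gauss_tail y < gauss_tail x"
  by (rule DERIV_neg_imp_decreasing) (auto intro!: derivative_eq_intros)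

lemma gauss_tail_pos: "0 < gauss_tail y"
  using gauss_tail_strict[of y "y+1"] gauss_tail_nonneg[of "y+1"] by linarith

lemma gauss_tail_uminus: "gauss_tail (- y) = 1 - gauss_tail y"
proof -
  have "gauss_tail y = measure (distr std_gauss borel uminus) {y..}"
    by (simp add: distr_std_gauss_uminus gauss_tail_def)
  also have "\<dots> = measure std_gauss {..-y}"
    by (subst measure_distr) (auto intro!: arg_cong[where f="measure _"])
  also have "\<dots> = measure std_gauss {..<-y}"
  proof -
    have "AE t in std_gauss. t \<noteq> -y"
      using AE_lborel_singleton[of "-y"] by (simp add: AE_density)
    then show ?thesis by (intro std_gauss.finite_measure_eq_AE) auto
  qed
  also have "{..<-y} = space std_gauss - {-y..}" by auto
  also have "measure std_gauss \<dots> = 1 - gauss_tail (-y)"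
    by (subst std_gauss.prob_compl) (auto simp: gauss_tail_def)
  finally show ?thesis by simp
qed

lemma gauss_tail_0: "gauss_tail 0 = 1 / 2"
  using gauss_tail_uminus[of 0] by simp

section \<open>Differential inequalities for the tail and its hazard rate\<close>

lemma nonneg_of_DERIV_sign_change:
  fixes f :: "real \<Rightarrow> real"
  assumes der: "\<And>x. a \<le> x \<Longrightarrow> DERIV f x :> f' x"
    and sign: "\<And>x y. a < x \<Longrightarrow> x < y \<Longrightarrow> f' x < 0 \<Longrightarrow> f' y \<le> 0"
    and "0 \<le> f a" and lim: "(f \<longlongrightarrow> 0) at_top" and "a \<le> x"
  shows "0 \<le> f x"
proof (rule ccontr)
  assume neg: "\<not> 0 \<le> f x"
  with assms have "a < x" by (metis order_le_less)
  \<comment> \<open>The mean value theorem gives a point before x with negative derivative. As f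
    tends to 0 it must later rise from its negative value at x, giving a later point with positive
    derivative, which \<open>sign\<close> forbids.\<close>
  then obtain y where y: "a < y" "y < x" "f x - f a = (x - a) * f' y"
    using MVT2[of a x f f'] der by auto
  have "(x - a) * f' y < 0" using y neg \<open>0 \<le> f a\<close> by linarith
  then have "f' y < 0" using \<open>a < x\<close> by (simp add: mult_less_0_iff)
  have "\<forall>\<^sub>F z in at_top. f x < f z \<and> x < z"
    using lim neg by (intro eventually_conj order_tendstoD eventually_gt_at_top) auto
  then obtain z where z: "f x < f z" "x < z"
    by (metis (no_types, lifting) eventually_happens' trivial_limit_at_top_linorder)
  then obtain w where w: "x < w" "w < z" "f z - f x = (z - x) * f' w"
    using MVT2[of x z f f'] der \<open>a < x\<close> by auto
  have "0 < (z - x) * f' w" using w z by linarith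
  then have "0 < f' w" using z by (simp add: zero_less_mult_iff)
  with sign[of y w] y w \<open>f' y < 0\<close> show False by auto
qed

text \<open>Both sides equal 1/2 at 0 and vanish at infinity, and the derivative of their difference
  has the sign of a decreasing linear function, hence changes sign only once.\<close>

lemma gauss_tail_le_half_exp:
  assumes "0 \<le> y" shows "gauss_tail y \<le> exp (- y\<^sup>2 / 2) / 2"
proof -
  let ?f = "\<lambda>y. exp (- y\<^sup>2 / 2) / 2 - gauss_tail y"
  let ?f' = "\<lambda>y. exp (- y\<^sup>2 / 2) * (1 / sqrt (2 * pi) - y / 2)"
  have "0 \<le> ?f y"
  proof (rule nonneg_of_DERIV_sign_change[where f = ?f and f' = ?f' and a = 0])
    show "DERIV ?f t :> ?f' t" for t
      by (auto intro!: derivative_eq_intros simp: std_normal_density_def field_simps)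
    show "?f' t \<le> 0" if "s < t" "?f' s < 0" for s t
      using that by (simp add: mult_less_0_iff mult_le_0_iff)
    have "((\<lambda>y::real. exp (- y\<^sup>2 / 2) / 2) \<longlongrightarrow> 0) at_top" by real_asymp
    from tendsto_diff[OF this gauss_tail_tendsto_0] show "(?f \<longlongrightarrow> 0) at_top" by simp
  qed (use assms in \<open>auto simp: gauss_tail_0\<close>)
  then show ?thesis by simp
qed

text \<open>The difference has derivative \<open>- gauss_tail t\<close>, since the terms
  \<open>t * std_normal_density t\<close> cancel; so for nonnegative t it decreases to its limit
  0.\<close>

lemma gauss_tail_mills:
  shows "t * gauss_tail t \<le> std_normal_density t"
proof (cases "0 \<le> t")
  case True
  let ?f = "\<lambda>t. std_normal_density t - t * gauss_tail t"
  have *: "((\<lambda>t. t * gauss_tail t) \<longlongrightarrow> 0) at_top"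
  proof (rule tendsto_sandwich[where f = "\<lambda>_. 0" and h = "\<lambda>t. t * (exp (- t\<^sup>2 / 2) / 2)"])
    show "\<forall>\<^sub>F t in at_top. t * gauss_tail t \<le> t * (exp (- t\<^sup>2 / 2) / 2)"
      using eventually_ge_at_top[of 0] by eventually_elim (intro mult_left_mono gauss_tail_le_half_exp)
    show "\<forall>\<^sub>F t in at_top. 0 \<le> t * gauss_tail t"
      using eventually_ge_at_top[of 0] by eventually_elim (simp add: gauss_tail_nonneg)
    show "((\<lambda>t::real. t * (exp (- t\<^sup>2 / 2) / 2)) \<longlongrightarrow> 0) at_top" by real_asymp
  qed simp
  have "0 \<le> ?f t"
  proof (rule nonneg_of_DERIV_sign_change[where f = ?f and f' = "\<lambda>t. - gauss_tail t" and a = 0])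
    show "DERIV ?f t :> - gauss_tail t" for t
      by (auto intro!: derivative_eq_intros)
    have "(std_normal_density \<longlongrightarrow> 0) at_top" unfolding std_normal_density_def by real_asymp
    from tendsto_diff[OF this *] show "(?f \<longlongrightarrow> 0) at_top" by simp
  qed (use True gauss_tail_nonneg in auto)
  then show ?thesis by simp
next
  case False
  then have "t * gauss_tail t \<le> 0" by (simp add: mult_nonpos_nonneg gauss_tail_nonneg)
  also have "\<dots> \<le> std_normal_density t" by simp
  finally show ?thesis .
qed

text \<open>The derivative of the quotient is nonnegative by \<open>gauss_tail_mills\<close>.
  Monotonicity of the hazard rate is log-concavity of the tail.\<close>

lemma gauss_hazard_mono:
  assumes "s \<le> t"
  shows "std_normal_density s / gauss_tail s \<le> std_normal_density t / gauss_tail t"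
proof (rule DERIV_nonneg_imp_nondecreasing[OF assms])
  fix x :: real
  have "DERIV (\<lambda>x. std_normal_density x / gauss_tail x) x
      :> std_normal_density x * (std_normal_density x - x * gauss_tail x) / (gauss_tail x)\<^sup>2"
    using gauss_tail_pos[of x]
    by (auto intro!: derivative_eq_intros simp: field_simps power2_eq_square)
  moreover have "0 \<le> std_normal_density x * (std_normal_density x - x * gauss_tail x) / (gauss_tail x)\<^sup>2"
    using gauss_tail_mills[of x] by simp
  ultimately show "\<exists>y. DERIV (\<lambda>x. std_normal_density x / gauss_tail x) x :> y \<and> 0 \<le> y" by blast
qed

text \<open>The concave function \<open>ln (gauss_tail t)\<close> has slope \<open>- k\<close> at x
  and lies below its tangent there; equivalently, \<open>?h\<close> is maximal at x.\<close>

lemma gauss_tail_le_exp_tangent: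
  assumes k: "k = std_normal_density x / gauss_tail x"
  shows "gauss_tail t \<le> gauss_tail x * exp (- k * (t - x))"
proof -
  let ?h = "\<lambda>t. ln (gauss_tail t) + k * t"
  have D: "DERIV ?h s :> k - std_normal_density s / gauss_tail s" for s
    using gauss_tail_pos[of s] by (auto intro!: derivative_eq_intros simp: field_simps)
  have "?h t \<le> ?h x"
  proof (cases "t \<le> x")
    case True
    then show ?thesis
    proof (rule DERIV_nonneg_imp_nondecreasing)
      fix s assume "t \<le> s" "s \<le> x"
      then show "\<exists>y. DERIV ?h s :> y \<and> 0 \<le> y"
        using D[of s] gauss_hazard_mono[of s x] k by force
    qed
  next
    case False
    then have "x \<le> t" by simp
    then show ?thesis
    proof (rule DERIV_nonpos_imp_nonincreasing)
      fix s assume "x \<le> s" "s \<le> t"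
      then show "\<exists>y. DERIV ?h s :> y \<and> y \<le> 0"
        using D[of s] gauss_hazard_mono[of x s] k by force
    qed
  qed
  then have "ln (gauss_tail t) \<le> ln (gauss_tail x) + (- k * (t - x))" by (simp add: algebra_simps)
  then have "exp (ln (gauss_tail t)) \<le> exp (ln (gauss_tail x) + (- k * (t - x)))" by (simp only: exp_le_cancel_iff)
  then show ?thesis using gauss_tail_pos[of t] gauss_tail_pos[of x] by (simp add: exp_diff exp_add exp_minus field_simps)
qed

text \<open>The polynomial is the integral of the degree 6 Taylor polynomial of
  \<open>exp (- t^2 / 2)\<close>, a lower bound for that function. It serves the numerical estimate
  at \<open>sqrt lam\<close>.\<close>

lemma gauss_tail_le_taylor:
  assumes "0 \<le> t"
  shows "gauss_tail t \<le> 1 / 2 - (t - t^3 / 6 + t^5 / 40 - t^7 / 336) / sqrt (2 * pi)"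
proof -
  define r where "r = 1 / sqrt (2 * pi)"
  let ?f = "\<lambda>t. 1 / 2 - (t - t^3 / 6 + t^5 / 40 - t^7 / 336) * r - gauss_tail t"
  have "?f 0 \<le> ?f t"
  proof (rule DERIV_nonneg_imp_nondecreasing[OF assms])
    fix x :: real
    obtain \<xi> where "exp (- x\<^sup>2 / 2) = (\<Sum>m<4. (- x\<^sup>2 / 2) ^ m / fact m) + exp \<xi> / fact 4 * (- x\<^sup>2 / 2) ^ 4"
      using Maclaurin_exp_le[of "- x\<^sup>2 / 2" 4] by blast
    then have "(\<Sum>m<4. (- x\<^sup>2 / 2) ^ m / fact m) \<le> exp (- x\<^sup>2 / 2)"
      by simp
    then have "1 - x^2 / 2 + x^4 / 8 - x^6 / 48 \<le> exp (- x\<^sup>2 / 2)"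
      by (simp add: eval_nat_numeral algebra_simps)
    then have "0 \<le> (exp (- x\<^sup>2 / 2) - (1 - x^2 / 2 + x^4 / 8 - x^6 / 48)) * r"
      by (intro mult_nonneg_nonneg) (auto simp: r_def)
    also have "\<dots> = std_normal_density x - (1 - x^2 / 2 + x^4 / 8 - x^6 / 48) * r"
      by (simp add: std_normal_density_def r_def algebra_simps)
    finally have "0 \<le> std_normal_density x - (1 - x^2 / 2 + x^4 / 8 - x^6 / 48) * r" .
    moreover have "DERIV ?f x :> std_normal_density x - (1 - x^2 / 2 + x^4 / 8 - x^6 / 48) * r"
      by (auto intro!: derivative_eq_intros)
    ultimately show "\<exists>y. DERIV ?f x :> y \<and> 0 \<le> y" by blast
  qed
  then show ?thesis by (simp add: gauss_tail_0 r_def)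
qed

section \<open>The shift by \<open>lam / x\<close>\<close>

lemma lam_eq: "lam = 3 - ln (9 / 2)"
proof -
  have "lam = ln (exp 1 ^ 3) + ln 2 - ln (9::real)"
    by (simp add: lam_def ln_mult ln_div)
  also have "ln (exp 1 ^ 3) = (3::real)" by (simp add: ln_realpow)
  finally show ?thesis by (simp add: ln_div)
qed

lemma exp_lam: "exp lam = 2 * exp 1 ^ 3 / 9"
  by (simp add: lam_def)

lemma lam_lower: "1.4958 \<le> lam"
proof -
  \<comment> \<open>\<open>0.7521\<close> is half of \<open>1.5042\<close>, a decimal just above
    \<open>ln (9 / 2)\<close>; halving keeps the Taylor sum short, and squaring recovers
    \<open>9 / 2\<close>.\<close>
  obtain \<xi> where "exp 0.7521 = (\<Sum>m<8. (0.7521::real) ^ m / fact m) + exp \<xi> / fact 8 * 0.7521 ^ 8"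
    using Maclaurin_exp_le[of "0.7521" 8] by blast
  then have "(\<Sum>m<8. (0.7521::real) ^ m / fact m) \<le> exp 0.7521" by simp
  then have "2.12140 \<le> exp (0.7521::real)"
    by (simp add: eval_nat_numeral)
  then have "2.12140 ^ 2 \<le> exp (0.7521::real) ^ 2" by (intro power_mono) auto
  also have "\<dots> = exp 1.5042" by (simp add: exp_double[symmetric])
  finally have "9 / 2 \<le> exp (1.5042::real)" by (simp add: power2_eq_square)
  then have "ln (9 / 2) \<le> ln (exp (1.5042::real))" by (subst ln_le_cancel_iff) auto
  then show ?thesis by (simp add: lam_eq)
qed

text \<open>The boundary case of \<open>gauss_tail_shift\<close>: at \<open>x = sqrt lam\<close> the
  shifted argument \<open>x - lam / x\<close> is 0.\<close>

lemma gauss_tail_sqrt_lam: "exp lam * gauss_tail (sqrt lam) \<le> 1 / 2"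
proof -
  have "1.223 \<le> sqrt lam"
    by (rule real_le_rsqrt) (use lam_lower in \<open>simp add: power2_eq_square\<close>)
  then have "gauss_tail (sqrt lam) \<le> gauss_tail 1.223" by (rule gauss_tail_antimono)
  also have "\<dots> \<le> 1 / 2 - (1.223 - 1.223^3 / 6 + 1.223^5 / 40 - 1.223^7 / 336) / sqrt (2 * pi)"
    by (rule gauss_tail_le_taylor) simp
  also have "\<dots> \<le> 1 / 2 - 0.9743 / sqrt (2 * pi)"
    by (intro diff_left_mono divide_right_mono) (auto simp: eval_nat_numeral)
  also have "sqrt (2 * pi) \<le> 2.5067"
    by (rule real_le_lsqrt) (use pi_approx in \<open>auto simp: power2_eq_square\<close>)
  then have "1 / 2 - 0.9743 / sqrt (2 * pi) \<le> 1 / 2 - 0.9743 / 2.5067"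
    by (intro diff_left_mono divide_left_mono) auto
  finally have q: "gauss_tail (sqrt lam) \<le> 0.1118" by simp
  have "exp 1 ^ 3 \<le> (2.72 :: real) ^ 3" using e_less_272 by (intro power_mono) auto
  then have "exp lam \<le> 4.472" by (simp add: exp_lam eval_nat_numeral)
  \<comment> \<open>The rounded bounds multiply to about \<open>0.49997\<close>; the true product is
    about \<open>0.494\<close>.\<close>
  then have "exp lam * gauss_tail (sqrt lam) \<le> 4.472 * 0.1118"
    using q gauss_tail_nonneg by (intro mult_mono) auto
  also have "\<dots> \<le> 1 / 2" by simp
  finally show ?thesis .
qed

text \<open>Concavity of \<open>ln\<close> on the segment from 1 to \<open>1 + t\<close> makes
  \<open>ln (1 + t) / t\<close> nonincreasing.\<close>

lemma ln_1_plus_ratio_antimono: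
  fixes s t :: real
  assumes "0 < s" "s \<le> t"
  shows "s / t * ln (1 + t) \<le> ln (1 + s)"
proof -
  have "(1 - s / t) * ln 1 + s / t * ln (1 + t) \<le> ln ((1 - s / t) *\<^sub>R 1 + (s / t) *\<^sub>R (1 + t))"
    using assms by (intro concave_onD[OF ln_concave]) auto
  also have "(1 - s / t) *\<^sub>R 1 + (s / t) *\<^sub>R (1 + t) = 1 + s"
    using assms by (simp add: field_simps)
  finally show ?thesis by simp
qed

text \<open>The derivative of the difference has the sign of \<open>lam / 2 - ln (1 + t) / t\<close>
  with \<open>t = lam / x^2\<close>. As x grows, t shrinks and \<open>ln (1 + t) / t\<close> grows,
  so the sign can only pass from positive to negative.\<close>

lemma gauss_tail_shift:
  assumes "sqrt lam \<le> x"
  shows "exp lam * gauss_tail x \<le> gauss_tail (x - lam / x)"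
proof -
  have lam_pos: "0 < lam" using lam_lower by simp
  then have sq_pos: "0 < sqrt lam" by simp
  let ?f = "\<lambda>x. gauss_tail (x - lam / x) - exp lam * gauss_tail x"
  let ?f' = "\<lambda>x. exp lam * std_normal_density x * (1 - exp (- lam\<^sup>2 / (2 * x\<^sup>2)) * (1 + lam / x\<^sup>2))"
  have sgn: "?f' x < 0 \<longleftrightarrow> lam / 2 * (lam / x\<^sup>2) < ln (1 + lam / x\<^sup>2)"
           "?f' x \<le> 0 \<longleftrightarrow> lam / 2 * (lam / x\<^sup>2) \<le> ln (1 + lam / x\<^sup>2)" if "0 < x" for x
  proof -
    have "0 < 1 + lam / x\<^sup>2" using that lam_pos by (simp add: add_pos_pos)
    then have "exp (- lam\<^sup>2 / (2 * x\<^sup>2)) * (1 + lam / x\<^sup>2) = exp (ln (1 + lam / x\<^sup>2) - lam / 2 * (lam / x\<^sup>2))"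
      by (simp add: exp_diff exp_minus field_simps power2_eq_square)
    moreover have "0 < exp lam * std_normal_density x" by simp
    note mult_less_cancel_left_pos[OF this, of _ 0] mult_le_cancel_left_pos[OF this, of _ 0]
    ultimately show "?f' x < 0 \<longleftrightarrow> lam / 2 * (lam / x\<^sup>2) < ln (1 + lam / x\<^sup>2)"
           "?f' x \<le> 0 \<longleftrightarrow> lam / 2 * (lam / x\<^sup>2) \<le> ln (1 + lam / x\<^sup>2)"
      by simp_all
  qed
  have "0 \<le> ?f x"
  proof (rule nonneg_of_DERIV_sign_change[where f = ?f and f' = ?f' and a = "sqrt lam"])
    fix x assume "sqrt lam \<le> x"
    then have x: "0 < x" using sq_pos by linarith
    have "std_normal_density (x - lam / x) = std_normal_density x * exp lam * exp (- lam\<^sup>2 / (2 * x\<^sup>2))"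
    proof -
      \<comment> \<open>The cross term of the square is the constant \<open>lam\<close>: this is how
        a shift by \<open>lam / x\<close> produces the factor \<open>exp lam\<close>.\<close>
      have "- (x - lam / x)\<^sup>2 / 2 = - x\<^sup>2 / 2 + lam + (- lam\<^sup>2 / (2 * x\<^sup>2))"
        using x by (simp add: field_simps power2_eq_square)
      then show ?thesis unfolding std_normal_density_def by (simp only: exp_add mult.assoc)
    qed
    then have eq: "- (std_normal_density (x - lam / x) * (1 + lam / (x * x))) + exp lam * std_normal_density x = ?f' x"
      by (simp add: algebra_simps power2_eq_square)
    show "DERIV ?f x :> ?f' x"
      unfolding eq[symmetric] using x by (auto intro!: derivative_eq_intros)
  next
    fix x y assume xy: "sqrt lam < x" "x < y" "?f' x < 0"
    then have x: "0 < x" "0 < y" using sq_pos by linarith+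
    define t where "t = lam / x\<^sup>2"
    define s where "s = lam / y\<^sup>2"
    have "0 < s" "s \<le> t" unfolding s_def t_def using x xy lam_pos
      by (auto intro!: divide_left_mono power_mono)
    have "lam / 2 * t < ln (1 + t)" using sgn(1)[OF x(1)] xy by (simp add: t_def)
    then have "s / t * (lam / 2 * t) \<le> s / t * ln (1 + t)"
      using \<open>0 < s\<close> \<open>s \<le> t\<close> by (intro mult_left_mono) auto
    also have "\<dots> \<le> ln (1 + s)" by (rule ln_1_plus_ratio_antimono) fact+
    finally have "lam / 2 * s \<le> ln (1 + s)" using \<open>0 < s\<close> \<open>s \<le> t\<close> by (simp add: field_simps)
    then show "?f' y \<le> 0" using sgn(2)[OF x(2)] by (simp add: s_def)
  next
    show "0 \<le> ?f (sqrt lam)"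
      using gauss_tail_sqrt_lam lam_pos by (simp add: real_div_sqrt gauss_tail_0)
  next
    have "filterlim (\<lambda>x. x - lam / x) at_top at_top" by real_asymp
    from tendsto_diff[OF filterlim_compose[OF gauss_tail_tendsto_0 this] tendsto_mult_left[OF gauss_tail_tendsto_0, of "exp lam"]]
    show "(?f \<longlongrightarrow> 0) at_top" by simp
  qed (fact assms)
  then show ?thesis by simp
qed

text \<open>Reflection with \<open>y = lam / x - x\<close> turns the claim into
  \<open>gauss_tail y \<le> s / (1 + s)\<close> for \<open>s = x^2\<close>. The bound
  \<open>exp (- y^2 / 2) / 2\<close> and \<open>1 + y^2 / 2 \<le> exp (y^2 / 2)\<close> reduce it to
  a quadratic inequality in s.\<close>

lemma cantelli_le_gauss_tail:
  assumes x: "0 < x" "x \<le> sqrt lam"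
  shows "1 / (1 + x\<^sup>2) \<le> gauss_tail (x - lam / x)"
proof -
  have lam_pos: "0 < lam" using lam_lower by simp
  define s where "s = x\<^sup>2"
  have s: "0 < s" using x by (simp add: s_def)
  define y where "y = lam / x - x"
  have "x\<^sup>2 \<le> lam" using x lam_pos real_sqrt_pow2[of lam] by (metis power_mono less_imp_le)
  then have "0 \<le> y" using x by (simp add: y_def field_simps power2_eq_square)
  have y2: "y\<^sup>2 = (lam - s)\<^sup>2 / s" using x by (simp add: y_def s_def field_simps power2_eq_square)
  \<comment> \<open>The completed square of \<open>s + (lam - s)^2 - 1\<close>, whose constant part
    is \<open>lam - 5 / 4\<close>.\<close>
  have "0 \<le> (s + (1 - 2 * lam) / 2)\<^sup>2 + (lam - 5 / 4)" using lam_lower by simp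
  then have "1 + s \<le> 2 * s + (lam - s)\<^sup>2"
    by (simp add: field_simps power2_eq_square)
  also have "(lam - s)\<^sup>2 = y\<^sup>2 * s" using s by (simp add: y2)
  finally have "1 + s \<le> 2 * s + y\<^sup>2 * s" .
  then have "(1 + s) / (2 * s) \<le> 1 + y\<^sup>2 / 2"
    using s by (simp add: field_simps)
  also have "\<dots> \<le> exp (y\<^sup>2 / 2)" by (rule exp_ge_add_one_self)
  finally have "exp (- y\<^sup>2 / 2) / 2 \<le> s / (1 + s)"
    using s by (simp add: exp_minus field_simps)
  with gauss_tail_le_half_exp[OF \<open>0 \<le> y\<close>] have "gauss_tail y \<le> s / (1 + s)" by linarith
  moreover have "gauss_tail (x - lam / x) = 1 - gauss_tail y"
    using gauss_tail_uminus[of y] by (simp add: y_def)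
  moreover have "1 / (1 + s) = 1 - s / (1 + s)" using s by (simp add: field_simps)
  ultimately show ?thesis by (simp add: s_def)
qed

section \<open>Gaussian moments of the test functions\<close>

lemma nn_integral_gauss_cube_le:
  fixes x u :: real
  defines "k \<equiv> std_normal_density x / gauss_tail x"
  shows "(\<integral>\<^sup>+t. ennreal ((max 0 (t - u))^3) \<partial>std_gauss) \<le> ennreal (gauss_tail x * exp (k * (x - u)) * (6 / k^3))"
proof -
  interpret P: pair_sigma_finite std_gauss lborel
    by (intro pair_sigma_finite.intro sigma_finite_lborel) (simp add: std_gauss.sigma_finite_measure_axioms)
  \<comment> \<open>An antiderivative of \<open>3 * (s - u)^2\<close> times the exponential majorant
    of the tail, by repeated integration by parts; at \<open>s = u\<close> only
    \<open>6 / k^3\<close> survives in the bracket.\<close>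
  let ?F = "\<lambda>s. - (gauss_tail x * exp (- k * (s - x)) * (3 * (s - u)\<^sup>2 / k + 6 * (s - u) / k\<^sup>2 + 6 / k^3))"
  have k: "0 < k" by (simp add: k_def gauss_tail_pos)
  \<comment> \<open>Layer-cake form of the cube: once the integrals are exchanged, the integral over
    t becomes \<open>gauss_tail s\<close>, to which the exponential bound applies.\<close>
  have cube: "ennreal ((max 0 (t - u))^3) = (\<integral>\<^sup>+s. ennreal (3 * (s - u)\<^sup>2) * indicator {u..} s * indicator {s..} t \<partial>lborel)" for t
  proof (cases "u \<le> t")
    case True
    have "(\<integral>\<^sup>+s. ennreal (3 * (s - u)\<^sup>2) * indicator {u..} s * indicator {s..} t \<partial>lborel)
        = (\<integral>\<^sup>+s. ennreal (3 * (s - u)\<^sup>2) * indicator {u..t} s \<partial>lborel)"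
      by (intro nn_integral_cong) (auto split: split_indicator)
    also have "\<dots> = (t - u)^3 - (u - u)^3"
      by (rule nn_integral_FTC_Icc[where F = "\<lambda>s. (s - u)^3"])
         (use True in \<open>auto intro!: derivative_eq_intros\<close>)
    finally show ?thesis using True by (simp add: max_def)
  next
    case False
    have "(\<integral>\<^sup>+s. ennreal (3 * (s - u)\<^sup>2) * indicator {u..} s * indicator {s..} t \<partial>lborel) = 0"
      by (intro nn_integral_zero' AE_I2) (use False in \<open>auto split: split_indicator\<close>)
    then show ?thesis using False by (simp add: max_def)
  qed
  have ind [measurable]: "(\<lambda>(t :: real, s). indicator {s..} t :: ennreal) \<in> borel_measurable (borel \<Otimes>\<^sub>M borel)"
  proof -
    have "(\<lambda>(t :: real, s). indicator {s..} t :: ennreal) = indicator {z :: real \<times> real. snd z \<le> fst z}"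
      by (auto split: split_indicator)
    then show ?thesis by simp
  qed
  have "(\<integral>\<^sup>+t. ennreal ((max 0 (t - u))^3) \<partial>std_gauss)
      = (\<integral>\<^sup>+t. \<integral>\<^sup>+s. ennreal (3 * (s - u)\<^sup>2) * indicator {u..} s * indicator {s..} t \<partial>lborel \<partial>std_gauss)"
    by (simp only: cube)
  also have "\<dots> = (\<integral>\<^sup>+s. \<integral>\<^sup>+t. ennreal (3 * (s - u)\<^sup>2) * indicator {u..} s * indicator {s..} t \<partial>std_gauss \<partial>lborel)"
    by (rule P.Fubini'[symmetric]) measurable
  also have "\<dots> = (\<integral>\<^sup>+s. ennreal (3 * (s - u)\<^sup>2) * indicator {u..} s * ennreal (gauss_tail s) \<partial>lborel)"
    by (simp add: nn_integral_cmult emeasure_std_gauss_Ici)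
  also have "\<dots> \<le> (\<integral>\<^sup>+s. ennreal (3 * (s - u)\<^sup>2 * (gauss_tail x * exp (- k * (s - x)))) * indicator {u..} s \<partial>lborel)"
    using gauss_tail_le_exp_tangent[OF k_def[THEN meta_eq_to_obj_eq]]
    by (intro nn_integral_mono)
      (auto split: split_indicator simp: ennreal_mult[symmetric] gauss_tail_nonneg intro!: ennreal_leI mult_left_mono)
  also have "\<dots> = ennreal (0 - ?F u)"
  proof (rule nn_integral_FTC_atLeast[where F = ?F])
    show "(?F \<longlongrightarrow> 0) at_top"
      using k by real_asymp
    show "DERIV ?F s :> 3 * (s - u)\<^sup>2 * (gauss_tail x * exp (- k * (s - x)))" for s
      using k by (auto intro!: derivative_eq_intros simp: field_simps power2_eq_square power3_eq_cube)
  qed (use gauss_tail_nonneg in auto)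
  finally show ?thesis by (simp add: algebra_simps)
qed

lemma nn_integral_gauss_exp:
  "(\<integral>\<^sup>+t. ennreal (exp (h * t)) \<partial>std_gauss) = ennreal (exp (h\<^sup>2 / 2))"
proof -
  have "(\<integral>\<^sup>+t. ennreal (exp (h * t)) \<partial>std_gauss) = (\<integral>\<^sup>+t. ennreal (std_normal_density t) * ennreal (exp (h * t)) \<partial>lborel)"
    by (simp add: nn_integral_density)
  also have "\<dots> = (\<integral>\<^sup>+t. ennreal (exp (h\<^sup>2 / 2)) * ennreal (normal_density h 1 t) \<partial>lborel)"
  proof (intro nn_integral_cong)
    fix t
    have "std_normal_density t * exp (h * t) = exp (h\<^sup>2 / 2) * normal_density h 1 t"
      by (simp add: normal_density_def exp_add[symmetric] field_simps power2_eq_square)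
    then show "ennreal (std_normal_density t) * ennreal (exp (h * t)) = ennreal (exp (h\<^sup>2 / 2)) * ennreal (normal_density h 1 t)"
      by (simp add: ennreal_mult[symmetric])
  qed
  also have "\<dots> = ennreal (exp (h\<^sup>2 / 2))"
    by (simp add: nn_integral_cmult nn_integral_eq_integral)
  finally show ?thesis .
qed

lemma has_bochner_integral_std_gauss_square: "has_bochner_integral std_gauss (\<lambda>t. t\<^sup>2) 1"
  using std_normal_moment_even[of 1]
  by (intro has_bochner_integral_density) (auto simp: mult.commute)

lemma nn_integral_gauss_square: "(\<integral>\<^sup>+t. ennreal ((s + t)\<^sup>2) \<partial>std_gauss) = ennreal (1 + s\<^sup>2)"
proof -
  have "has_bochner_integral std_gauss (\<lambda>t. t) 0"
    using std_normal_moment_odd[of 0]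
    by (intro has_bochner_integral_density) (auto simp: mult.commute)
  from has_bochner_integral_mult_right[OF this, of "2 * s"]
  have lin: "has_bochner_integral std_gauss (\<lambda>t. 2 * s * t) 0" by simp
  have const: "has_bochner_integral std_gauss (\<lambda>_. s\<^sup>2) (s\<^sup>2)"
    using std_gauss.prob_space by (simp add: has_bochner_integral_iff)
  have "has_bochner_integral std_gauss (\<lambda>t. t\<^sup>2 + 2 * s * t + s\<^sup>2) (1 + 0 + s\<^sup>2)"
    by (intro has_bochner_integral_add has_bochner_integral_std_gauss_square lin const)
  moreover have "(\<lambda>t. t\<^sup>2 + 2 * s * t + s\<^sup>2) = (\<lambda>t. (s + t)\<^sup>2)"
    by (auto simp: power2_eq_square algebra_simps)
  ultimately have "has_bochner_integral std_gauss (\<lambda>t. (s + t)\<^sup>2) (1 + s\<^sup>2)" by simp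
  then show ?thesis by (intro nn_integral_eq_integral[THEN trans]) (auto simp: has_bochner_integral_iff)
qed

text \<open>The cube is dominated by a multiple of \<open>exp (x * t)\<close> with contact at
  \<open>t = x\<close>; the distance \<open>3 / x\<close> is what makes the rate of this exponential
  equal to x.\<close>

lemma nn_integral_gauss_cube_le_exp:
  assumes "0 < x"
  shows "(\<integral>\<^sup>+t. ennreal ((max 0 (t - (x - 3 / x)))^3) \<partial>std_gauss) \<le> ennreal ((3 / x)^3 * exp (- x\<^sup>2 / 2))"
proof -
  have le: "(max 0 (t - (x - 3 / x)))^3 \<le> (3 / x)^3 * exp (- x\<^sup>2) * exp (x * t)" for t
  proof -
    have "max 0 (t - (x - 3 / x)) = 3 / x * max 0 (1 + x * (t - x) / 3)"
      using assms by (auto simp: max_def field_simps power2_eq_square)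
    also have "\<dots> \<le> 3 / x * exp (x * (t - x) / 3)"
      using assms exp_ge_add_one_self[of "x * (t - x) / 3"] by (intro mult_left_mono) auto
    finally have "(max 0 (t - (x - 3 / x)))^3 \<le> (3 / x * exp (x * (t - x) / 3))^3"
      by (intro power_mono) auto
    also have "\<dots> = (3 / x)^3 * exp (x * (t - x))"
      using exp_of_nat_mult[of 3 "x * (t - x) / 3"] by (simp add: power_mult_distrib power_divide)
    also have "x * (t - x) = - x\<^sup>2 + x * t" by (simp add: power2_eq_square algebra_simps)
    finally show ?thesis by (simp only: exp_add mult.assoc)
  qed
  have "(\<integral>\<^sup>+t. ennreal ((max 0 (t - (x - 3 / x)))^3) \<partial>std_gauss)
      \<le> (\<integral>\<^sup>+t. ennreal ((3 / x)^3 * exp (- x\<^sup>2)) * ennreal (exp (x * t)) \<partial>std_gauss)"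
    using assms le by (intro nn_integral_mono) (simp add: ennreal_mult[symmetric] ennreal_leI)
  also have "\<dots> = ennreal ((3 / x)^3 * exp (- x\<^sup>2)) * ennreal (exp (x\<^sup>2 / 2))"
    by (subst nn_integral_cmult) (auto simp: nn_integral_gauss_exp)
  also have "\<dots> = ennreal ((3 / x)^3 * (exp (- x\<^sup>2) * exp (x\<^sup>2 / 2)))"
    using assms by (simp add: ennreal_mult[symmetric])
  also have "exp (- x\<^sup>2) * exp (x\<^sup>2 / 2) = exp (- x\<^sup>2 / 2)"
    by (simp add: exp_add[symmetric])
  finally show ?thesis .
qed

section \<open>Gaussian domination for a class of convex functions\<close>

text \<open>
  The second clause says that \<open>y \<mapsto> f (s + \<surd>y) + f (s - \<surd>y)\<close> has a supporting line at
  \<open>y = a\<^sup>2\<close>. Evaluated at \<open>y = a\<^sup>2 Z\<^sup>2\<close> and averaged, the linear term vanishes because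
  \<open>E Z\<^sup>2 = 1\<close>.
\<close>

definition gauss_test :: "(real \<Rightarrow> real) \<Rightarrow> bool"
  where "gauss_test f \<longleftrightarrow> convex_on UNIV f \<and> (\<forall>s. 0 \<le> f s) \<and>
    (\<forall>s a. \<exists>K. \<forall>t. f (s + a) + f (s - a) + K * (t\<^sup>2 - 1) \<le> f (s + a * t) + f (s - a * t))"

lemma gauss_test_nonneg: "gauss_test f \<Longrightarrow> 0 \<le> f s"
  by (simp add: gauss_test_def)

lemma gauss_test_measurable [measurable_dest]: "gauss_test f \<Longrightarrow> f \<in> borel_measurable borel"
  by (intro borel_measurable_continuous_onI convex_on_continuous) (auto simp: gauss_test_def)

lemma gauss_test_square: "gauss_test (\<lambda>t. t\<^sup>2)"
proof -
  have "\<exists>K. \<forall>t. (s + a)\<^sup>2 + (s - a)\<^sup>2 + K * (t\<^sup>2 - 1) \<le> (s + a * t)\<^sup>2 + (s - a * t)\<^sup>2" for s a :: real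
    \<comment> \<open>For the square the two sides agree: both are
      \<open>2 * s^2 + 2 * a^2 * t^2\<close>.\<close>
    by (rule exI[of _ "2 * a\<^sup>2"]) (simp add: power2_eq_square algebra_simps)
  then show ?thesis by (auto simp: gauss_test_def convex_power2)
qed

text \<open>In the variable \<open>v = y^2\<close> the symmetrized cube is linear or 0 up to
  \<open>v = s^2\<close> and equals \<open>(s + sqrt v)^3\<close> from there on. K is its slope at
  \<open>v = a^2\<close>, on whichever piece that point lies.\<close>

lemma symmetrized_cube_tangent:
  fixes s a :: real
  defines "p \<equiv> \<lambda>t :: real. (max 0 t) ^ 3"
  assumes a_nonneg: "0 \<le> a"
  obtains K where "\<And>y. 0 \<le> y \<Longrightarrow> p (s + a) + p (s - a) + K * (y\<^sup>2 - a\<^sup>2) \<le> p (s + y) + p (s - y)"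
proof -
  have outer: "p (s + y) + p (s - y) = (s + y) ^ 3" if "\<bar>s\<bar> \<le> y" for y
    using that by (auto simp: p_def max_def)
  have inner: "p (s + y) + p (s - y) = 2 * s ^ 3 + 6 * s * y\<^sup>2" if "0 \<le> y" "y \<le> s" for y
    using that by (simp add: p_def) (simp add: power3_eq_cube power2_eq_square algebra_simps)
  have nonneg: "0 \<le> p (s + y) + p (s - y)" for y by (simp add: p_def)
  consider (small) "a \<le> s" | (zero) "a \<le> - s" | (large) "\<bar>s\<bar> < a" by linarith
  then show thesis
  proof cases
    case a: small
    show thesis
    proof (rule that[of "6 * s"])
      fix y :: real assume y: "0 \<le> y"
      show "p (s + a) + p (s - a) + 6 * s * (y\<^sup>2 - a\<^sup>2) \<le> p (s + y) + p (s - y)"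
      proof (cases "y \<le> s")
        case True
        then show ?thesis using inner[of y] inner[of a] y a a_nonneg by (simp add: algebra_simps)
      next
        case False
        \<comment> \<open>The excess of the outer piece over the continued linear piece.\<close>
        then have "0 \<le> (y - s) ^ 3" by simp
        also have "(y - s) ^ 3 = (s + y) ^ 3 - (2 * s ^ 3 + 6 * s * y\<^sup>2)"
          by (simp add: power3_eq_cube power2_eq_square algebra_simps)
        finally have "2 * s ^ 3 + 6 * s * y\<^sup>2 \<le> (s + y) ^ 3" by simp
        then show ?thesis using outer[of y] inner[of a] False a a_nonneg
          by (simp add: algebra_simps)
      qed
    qed
  next
    case zero
    then have "p (s + a) + p (s - a) = 0" using a_nonneg by (simp add: p_def)
    then show thesis by (intro that[of 0]) (simp add: nonneg)
  next
    case a: large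
    \<comment> \<open>The derivative of \<open>(s + sqrt v)^3\<close> at
      \<open>v = a^2\<close>.\<close>
    define K where "K = 3 * (s + a)\<^sup>2 / (2 * a)"
    have "0 < a" using a by linarith
    have K_nonneg: "0 \<le> K" using \<open>0 < a\<close> by (simp add: K_def)
    have far: "(s + a) ^ 3 + K * (y\<^sup>2 - a\<^sup>2) \<le> (s + y) ^ 3" if y: "\<bar>s\<bar> \<le> y" for y
    proof -
      \<comment> \<open>Tangency makes \<open>y = a\<close> a double root of the gap; the remaining
        factor \<open>a * (2 * y + a) - 3 * s^2\<close> is nonnegative because \<bar>s\<bar> is at
        most y and at most a.\<close>
      have "0 \<le> (a - \<bar>s\<bar>) * (a + 3 * \<bar>s\<bar>)" using a by (intro mult_nonneg_nonneg) auto
      also have "\<dots> = a * (2 * \<bar>s\<bar> + a) - 3 * \<bar>s\<bar>\<^sup>2" by (simp add: power2_eq_square algebra_simps)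
      also have "\<dots> \<le> a * (2 * y + a) - 3 * s\<^sup>2" using y \<open>0 < a\<close> by simp
      finally have "0 \<le> (y - a)\<^sup>2 * (a * (2 * y + a) - 3 * s\<^sup>2)" by simp
      also have "\<dots> = 2 * a * ((s + y) ^ 3 - (s + a) ^ 3 - K * (y\<^sup>2 - a\<^sup>2))"
        using \<open>0 < a\<close> by (simp add: K_def field_simps power3_eq_cube power2_eq_square)
      finally show ?thesis using \<open>0 < a\<close> by (simp add: zero_le_mult_iff)
    qed
    show thesis
    proof (rule that[of K])
      fix y :: real assume y: "0 \<le> y"
      have "(s + a) ^ 3 + K * (y\<^sup>2 - a\<^sup>2) \<le> p (s + y) + p (s - y)"
      proof (cases "\<bar>s\<bar> \<le> y")
        case True
        then show ?thesis using far outer by simp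
      next
        case near: False
        then have y2: "y\<^sup>2 \<le> s\<^sup>2" using y power_mono[of y "\<bar>s\<bar>" 2] by simp
        \<comment> \<open>Start from the bound at the junction \<open>y = \<bar>s\<bar>\<close> and
          move left: the tangent falls at rate K, which is at least the slope of the inner piece,
          namely \<open>6 * s\<close> or 0.\<close>
        from far[of "\<bar>s\<bar>"] have *: "(s + a) ^ 3 + K * (s\<^sup>2 - a\<^sup>2) \<le> (s + \<bar>s\<bar>) ^ 3" by simp
        show ?thesis
        proof (cases "0 \<le> s")
          case True
          \<comment> \<open>\<open>K - 6 * s\<close> equals
            \<open>3 * (a - s)^2 / (2 * a)\<close>.\<close>
          have "0 \<le> (a - s)\<^sup>2" by simp
          then have "6 * s \<le> K" using \<open>0 < a\<close> by (simp add: K_def field_simps power2_eq_square)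
          then have "0 \<le> (K - 6 * s) * (s\<^sup>2 - y\<^sup>2)" using y2 by (intro mult_nonneg_nonneg) auto
          with * True have "(s + a) ^ 3 + K * (y\<^sup>2 - a\<^sup>2) \<le> 2 * s ^ 3 + 6 * s * y\<^sup>2"
            by (simp add: algebra_simps power3_eq_cube power2_eq_square)
          then show ?thesis using inner[of y] y near True by simp
        next
          case False
          have "K * (y\<^sup>2 - a\<^sup>2) \<le> K * (s\<^sup>2 - a\<^sup>2)" using y2 K_nonneg by (intro mult_left_mono) auto
          with * False nonneg[of y] show ?thesis by simp
        qed
      qed
      then show "p (s + a) + p (s - a) + K * (y\<^sup>2 - a\<^sup>2) \<le> p (s + y) + p (s - y)"
        using outer[of a] a by simp
    qed
  qed
qed

lemma convex_on_pos_part_cube: "convex_on UNIV (\<lambda>t :: real. (max 0 t) ^ 3)"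
proof (rule convex_onI)
  fix \<theta> x y :: real assume \<theta>: "0 < \<theta>" "\<theta> < 1"
  have "max 0 ((1 - \<theta>) * x + \<theta> * y) \<le> (1 - \<theta>) * max 0 x + \<theta> * max 0 y"
    using \<theta> by (intro max.boundedI add_mono mult_left_mono) auto
  then have "(max 0 ((1 - \<theta>) * x + \<theta> * y)) ^ 3 \<le> ((1 - \<theta>) * max 0 x + \<theta> * max 0 y) ^ 3"
    by (intro power_mono) auto
  also have "\<dots> \<le> (1 - \<theta>) * (max 0 x) ^ 3 + \<theta> * (max 0 y) ^ 3"
    using convex_onD[OF convex_power_odd[of 3], of \<theta> "max 0 x" "max 0 y"] \<theta> by simp
  finally show "(max 0 ((1 - \<theta>) *\<^sub>R x + \<theta> *\<^sub>R y)) ^ 3 \<le> (1 - \<theta>) * (max 0 x) ^ 3 + \<theta> * (max 0 y) ^ 3"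
    by simp
qed simp

lemma gauss_test_cube: "gauss_test (\<lambda>t. (max 0 t) ^ 3)"
  unfolding gauss_test_def
proof (intro conjI allI convex_on_pos_part_cube)
  fix s a :: real
  let ?p = "\<lambda>t :: real. (max 0 t) ^ 3"
  have sym: "?p (s + \<bar>y\<bar>) + ?p (s - \<bar>y\<bar>) = ?p (s + y) + ?p (s - y)" for y
    by (simp add: abs_if)
  show "\<exists>K. \<forall>t. ?p (s + a) + ?p (s - a) + K * (t\<^sup>2 - 1) \<le> ?p (s + a * t) + ?p (s - a * t)"
  proof (rule symmetrized_cube_tangent[OF abs_ge_zero, of s a])
    fix K assume K: "?p (s + \<bar>a\<bar>) + ?p (s - \<bar>a\<bar>) + K * (y\<^sup>2 - \<bar>a\<bar>\<^sup>2) \<le> ?p (s + y) + ?p (s - y)"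
      if "0 \<le> y" for y
    \<comment> \<open>The tangent at \<bar>a\<bar> is evaluated at
      \<open>y = \<bar>a * t\<bar>\<close>; evenness in y removes the absolute values, and the slope
      is rescaled by \<open>a^2\<close>.\<close>
    have "?p (s + a) + ?p (s - a) + K * a\<^sup>2 * (t\<^sup>2 - 1) \<le> ?p (s + a * t) + ?p (s - a * t)" for t
      using K[of "\<bar>a * t\<bar>"] unfolding sym by (simp add: algebra_simps)
    then show ?thesis by blast
  qed
qed simp

text \<open>The step from a Rademacher to a normal variable: averaging the supporting line over t
  kills \<open>t^2 - 1\<close>, and by symmetry both terms on the other side have the same
  mean.\<close>

lemma gauss_test_midpoint:
  assumes "gauss_test f"
  shows "ennreal ((f (s + a) + f (s - a)) / 2) \<le> (\<integral>\<^sup>+t. ennreal (f (s + a * t)) \<partial>std_gauss)"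
proof -
  note [measurable] = gauss_test_measurable[OF assms]
  note nn = gauss_test_nonneg[OF assms]
  obtain K where K: "f (s + a) + f (s - a) + K * (t\<^sup>2 - 1) \<le> f (s + a * t) + f (s - a * t)" for t
    using assms unfolding gauss_test_def by blast
  have sym: "(\<integral>\<^sup>+t. ennreal (f (s - a * t)) \<partial>std_gauss) = (\<integral>\<^sup>+t. ennreal (f (s + a * t)) \<partial>std_gauss)"
    using nn_integral_std_gauss_uminus[of "\<lambda>t. ennreal (f (s + a * t))"] by simp
  show ?thesis
  proof (cases "(\<integral>\<^sup>+t. ennreal (f (s + a * t)) \<partial>std_gauss) = \<infinity>")
    \<comment> \<open>A finite right side makes both reflected integrands integrable, so Bochner
      integrals may be used.\<close>
    case False
    then have fin: "(\<integral>\<^sup>+t. ennreal (f (s + a * t)) \<partial>std_gauss) < \<infinity>" by (simp add: less_top)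
    have i1: "integrable std_gauss (\<lambda>t. f (s + a * t))" and i2: "integrable std_gauss (\<lambda>t. f (s - a * t))"
      using fin sym nn by (auto intro!: integrableI_nonneg)
    note sq = has_bochner_integral_std_gauss_square
    have "(\<integral>t. f (s + a) + f (s - a) + K * (t\<^sup>2 - 1) \<partial>std_gauss) \<le> (\<integral>t. f (s + a * t) + f (s - a * t) \<partial>std_gauss)"
      using i1 i2 sq K by (intro integral_mono) (auto simp: has_bochner_integral_iff)
    also have "(\<integral>t. f (s + a) + f (s - a) + K * (t\<^sup>2 - 1) \<partial>std_gauss) = f (s + a) + f (s - a)"
      using sq std_gauss.prob_space by (simp add: has_bochner_integral_iff)
    also have "(\<integral>t. f (s + a * t) + f (s - a * t) \<partial>std_gauss) = 2 * (\<integral>t. f (s + a * t) \<partial>std_gauss)"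
      using i1 i2 sym nn by (simp add: integral_eq_nn_integral)
    finally have "(f (s + a) + f (s - a)) / 2 \<le> (\<integral>t. f (s + a * t) \<partial>std_gauss)" by simp
    then have "ennreal ((f (s + a) + f (s - a)) / 2) \<le> ennreal (\<integral>t. f (s + a * t) \<partial>std_gauss)"
      by (rule ennreal_leI)
    also have "\<dots> = (\<integral>\<^sup>+t. ennreal (f (s + a * t)) \<partial>std_gauss)"
      using i1 nn by (simp add: nn_integral_eq_integral)
    finally show ?thesis .
  qed simp
qed

text \<open>Centred normal noise cannot lower the mean of a convex function. This absorbs the
  unspent variance in the base case of \<open>gauss_test_partial_sum\<close>.\<close>

lemma gauss_test_le_gauss:
  assumes "gauss_test f"
  shows "ennreal (f s) \<le> (\<integral>\<^sup>+t. ennreal (f (s + a * t)) \<partial>std_gauss)"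
proof -
  have "f ((1 - 1/2) *\<^sub>R (s - a) + (1/2) *\<^sub>R (s + a)) \<le> (1 - 1/2) * f (s - a) + (1/2) * f (s + a)"
    using assms by (intro convex_onD[of UNIV]) (auto simp: gauss_test_def)
  also have "(1 - 1/2) *\<^sub>R (s - a) + (1/2) *\<^sub>R (s + a) = s" by (simp add: field_simps)
  finally have "f s \<le> (f (s + a) + f (s - a)) / 2" by simp
  then have "ennreal (f s) \<le> ennreal ((f (s + a) + f (s - a)) / 2)" by (rule ennreal_leI)
  also note gauss_test_midpoint[OF assms]
  finally show ?thesis .
qed

text \<open>On \<open>[-1, 1]\<close> the convex function \<open>y \<mapsto> f (s + a * y)\<close>
  lies below its chord \<open>?c\<close>, and since X has mean 0 the chord averages to the
  Rademacher value.\<close>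

lemma (in prob_space) gauss_test_bounded_rv:
  fixes X :: "'a \<Rightarrow> real"
  assumes f: "gauss_test f" and [measurable]: "random_variable borel X"
    and mean: "expectation X = 0" and bd: "AE \<omega> in M. \<bar>X \<omega>\<bar> \<le> 1"
  shows "(\<integral>\<^sup>+\<omega>. ennreal (f (s + a * X \<omega>)) \<partial>M) \<le> (\<integral>\<^sup>+t. ennreal (f (s + a * t)) \<partial>std_gauss)"
proof -
  note nn = gauss_test_nonneg[OF f]
  have int: "integrable M X" by (rule integrable_const_bound[of _ 1]) (use bd in auto)
  let ?c = "\<lambda>y. (1 - (1 + y) / 2) * f (s - a) + (1 + y) / 2 * f (s + a)"
  have le: "f (s + a * y) \<le> ?c y \<and> 0 \<le> ?c y" if "\<bar>y\<bar> \<le> 1" for y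
  proof
    have "f ((1 - (1 + y) / 2) *\<^sub>R (s - a) + ((1 + y) / 2) *\<^sub>R (s + a)) \<le> ?c y"
      using f that by (intro convex_onD[of UNIV]) (auto simp: gauss_test_def)
    also have "(1 - (1 + y) / 2) *\<^sub>R (s - a) + ((1 + y) / 2) *\<^sub>R (s + a) = s + a * y"
      by (simp add: field_simps)
    finally show "f (s + a * y) \<le> ?c y" .
    then show "0 \<le> ?c y" using nn[of "s + a * y"] by linarith
  qed
  have "(\<integral>\<^sup>+\<omega>. ennreal (f (s + a * X \<omega>)) \<partial>M) \<le> (\<integral>\<^sup>+\<omega>. ennreal (?c (X \<omega>)) \<partial>M)"
    using bd by (intro nn_integral_mono_AE) (auto elim!: eventually_mono intro!: ennreal_leI dest: le)
  also have "\<dots> = ennreal (\<integral>\<omega>. ?c (X \<omega>) \<partial>M)"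
    using bd int by (intro nn_integral_eq_integral) (auto elim!: eventually_mono dest: le)
  also have "(\<integral>\<omega>. ?c (X \<omega>) \<partial>M) = (f (s + a) + f (s - a)) / 2"
    using int mean prob_space by (simp add: field_simps)
  also note gauss_test_midpoint[OF f]
  finally show ?thesis .
qed

section \<open>Addition of independent normal variables\<close>

lemma nn_integral_gauss_add_pos:
  assumes [measurable]: "f \<in> borel_measurable borel" and ab: "0 < a" "0 < b"
  shows "(\<integral>\<^sup>+t. \<integral>\<^sup>+r. f (s + a * t + b * r) \<partial>std_gauss \<partial>std_gauss)
    = (\<integral>\<^sup>+t. f (s + sqrt (a\<^sup>2 + b\<^sup>2) * t) \<partial>std_gauss)"
proof -
  let ?N = "\<lambda>\<sigma>. density lborel (\<lambda>t. ennreal (normal_density 0 \<sigma> t))"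
  have sc: "(\<integral>\<^sup>+t. g (c * t) \<partial>std_gauss) = (\<integral>\<^sup>+t. g t \<partial>?N c)"
    if [measurable]: "g \<in> borel_measurable borel" and "0 < c" for g c
  proof -
    have "?N c = distr std_gauss borel (\<lambda>t. c * t)"
      using distr_std_gauss_scale[of c] \<open>0 < c\<close> by simp
    then show ?thesis by (simp add: nn_integral_distr)
  qed
  have fin: "finite_measure (?N c)" if "0 < c" for c
    using prob_space_normal_density[OF that] by (simp add: prob_space.finite_measure)
  have pos: "0 < sqrt (a\<^sup>2 + b\<^sup>2)" using ab by (simp add: add_pos_pos)
  interpret B: finite_measure "?N b" using fin ab by blast
  have meas: "(\<lambda>x. \<integral>\<^sup>+y. f (s + (x + y)) \<partial>?N b) \<in> borel_measurable borel"
    by measurable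
  have "(\<integral>\<^sup>+r. f (s + a * t + b * r) \<partial>std_gauss) = (\<integral>\<^sup>+y. f (s + (a * t + y)) \<partial>?N b)" for t
    using sc[of "\<lambda>y. f (s + (a * t + y))" b] ab by (simp add: add.assoc)
  then have "(\<integral>\<^sup>+t. \<integral>\<^sup>+r. f (s + a * t + b * r) \<partial>std_gauss \<partial>std_gauss)
      = (\<integral>\<^sup>+x. \<integral>\<^sup>+y. f (s + (x + y)) \<partial>?N b \<partial>?N a)"
    using sc[OF meas, of a] ab by simp
  also have "\<dots> = (\<integral>\<^sup>+x. f (s + x) \<partial>(?N a \<star> ?N b))"
    using ab fin by (subst nn_integral_convolution) auto
  also have "?N a \<star> ?N b = density lborel (\<lambda>x. \<integral>\<^sup>+y. ennreal (normal_density 0 a (x - y)) * ennreal (normal_density 0 b y) \<partial>lborel)"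
    using ab fin by (intro convolution_density) auto
  also have "\<dots> = ?N (sqrt (a\<^sup>2 + b\<^sup>2))"
    using conv_normal_density_zero_mean[OF ab] by (simp add: ennreal_mult)
  also have "(\<integral>\<^sup>+x. f (s + x) \<partial>?N (sqrt (a\<^sup>2 + b\<^sup>2))) = (\<integral>\<^sup>+t. f (s + sqrt (a\<^sup>2 + b\<^sup>2) * t) \<partial>std_gauss)"
    using sc[of "\<lambda>x. f (s + x)", OF _ pos] by simp
  finally show ?thesis .
qed

text \<open>Zero coefficients are separate because the normal density degenerates there; negative a
  reduces to \<open>- a\<close> by symmetry of the normal law.\<close>

lemma nn_integral_gauss_add:
  assumes [measurable]: "f \<in> borel_measurable borel" and ab: "0 \<le> b"
  shows "(\<integral>\<^sup>+t. \<integral>\<^sup>+r. f (s + a * t + b * r) \<partial>std_gauss \<partial>std_gauss)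
    = (\<integral>\<^sup>+t. f (s + sqrt (a\<^sup>2 + b\<^sup>2) * t) \<partial>std_gauss)"
proof -
  have *: "(\<integral>\<^sup>+t. \<integral>\<^sup>+r. f (s + a * t + b * r) \<partial>std_gauss \<partial>std_gauss)
    = (\<integral>\<^sup>+t. f (s + sqrt (a\<^sup>2 + b\<^sup>2) * t) \<partial>std_gauss)" if a: "0 \<le> a" for a
  proof (cases "a = 0 \<or> b = 0")
    case True
    then show ?thesis using a ab std_gauss.emeasure_space_1 by auto
  next
    case False
    then show ?thesis using a ab by (intro nn_integral_gauss_add_pos) auto
  qed
  show ?thesis
  proof (cases "0 \<le> a")
    case False
    have "(\<integral>\<^sup>+t. \<integral>\<^sup>+r. f (s + a * t + b * r) \<partial>std_gauss \<partial>std_gauss)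
      = (\<integral>\<^sup>+t. \<integral>\<^sup>+r. f (s + (- a) * t + b * r) \<partial>std_gauss \<partial>std_gauss)"
      by (subst nn_integral_std_gauss_uminus[symmetric]) auto
    then show ?thesis using *[of "- a"] False by simp
  qed (rule *)
qed

text \<open>Along the recursion \<open>W n\<close> becomes a measurable function of the variables
  with index below n, hence independent of \<open>X n\<close>. A general step \<open>\<Phi>\<close>
  covers plain and stopped partial sums alike.\<close>

lemma (in prob_space) indep_var_recursion:
  fixes X W :: "nat \<Rightarrow> 'a \<Rightarrow> real"
  assumes ind: "indep_vars (\<lambda>_. borel) X UNIV"
    and W_0: "\<And>\<omega>. W 0 \<omega> = c"
    and W_Suc: "\<And>n \<omega>. W (Suc n) \<omega> = \<Phi> n (W n \<omega>) (X n \<omega>)"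
    and \<Phi> [measurable]: "\<And>n. (\<lambda>(w, x). \<Phi> n w x) \<in> borel_measurable (borel \<Otimes>\<^sub>M borel)"
  shows "indep_var borel (W n) borel (X n)"
proof -
  have "\<exists>h \<in> borel_measurable (PiM {..<n} (\<lambda>_. borel)). \<forall>\<omega>. W n \<omega> = h (restrict (\<lambda>i. X i \<omega>) {..<n})"
  proof (induction n)
    case 0
    show ?case using W_0 by (intro bexI[of _ "\<lambda>_. c"]) auto
  next
    case (Suc n)
    then obtain h where [measurable]: "h \<in> borel_measurable (PiM {..<n} (\<lambda>_. borel))"
      and h: "\<And>\<omega>. W n \<omega> = h (restrict (\<lambda>i. X i \<omega>) {..<n})" by blast
    let ?h = "\<lambda>v. \<Phi> n (h (restrict v {..<n})) (v n)"
    have [measurable]: "(\<lambda>v. restrict v {..<n}) \<in> measurable (PiM {..<Suc n} (\<lambda>_. borel :: real measure)) (PiM {..<n} (\<lambda>_. borel))"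
      by (intro measurable_restrict_subset) auto
    have [measurable]: "(\<lambda>v. v n) \<in> measurable (PiM {..<Suc n} (\<lambda>_. borel :: real measure)) borel"
      by (intro measurable_component_singleton) auto
    have h_meas: "?h \<in> borel_measurable (PiM {..<Suc n} (\<lambda>_. borel))"
      using measurable_compose[OF _ \<Phi>[of n], of "\<lambda>v. (h (restrict v {..<n}), v n)" "PiM {..<Suc n} (\<lambda>_. borel)"]
      by simp
    have h_eq: "W (Suc n) \<omega> = ?h (restrict (\<lambda>i. X i \<omega>) {..<Suc n})" for \<omega>
    proof -
      have "{..<Suc n} \<inter> {..<n} = {..<n}" by auto
      then show ?thesis by (simp add: W_Suc h)
    qed
    show ?case by (rule bexI[of _ ?h], rule allI, rule h_eq, rule h_meas)
  qed
  then obtain h where h [measurable]: "h \<in> borel_measurable (PiM {..<n} (\<lambda>_. borel))"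
    and W: "\<And>\<omega>. W n \<omega> = h (restrict (\<lambda>i. X i \<omega>) {..<n})" by blast
  have "indep_var (PiM {..<n} (\<lambda>_. borel)) (\<lambda>\<omega>. restrict (\<lambda>i. X i \<omega>) {..<n})
      (PiM {n} (\<lambda>_. borel)) (\<lambda>\<omega>. restrict (\<lambda>i. X i \<omega>) {n})"
    by (rule indep_var_restrict[OF ind]) auto
  from indep_var_compose[OF this h, of "\<lambda>v. v n" borel]
  have "indep_var borel (h \<circ> (\<lambda>\<omega>. restrict (\<lambda>i. X i \<omega>) {..<n})) borel ((\<lambda>v. v n) \<circ> (\<lambda>\<omega>. restrict (\<lambda>i. X i \<omega>) {n}))"
    by (simp add: measurable_component_singleton)
  then show ?thesis by (simp add: comp_def W[symmetric])
qed

section \<open>Almost sure convergence of the series\<close>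

text \<open>Partial sums of \<open>x\<close> from index \<open>m\<close> on, frozen as soon as they leave \<open>(-e, e)\<close>.\<close>

primrec stopped_sum :: "real \<Rightarrow> nat \<Rightarrow> (nat \<Rightarrow> real) \<Rightarrow> nat \<Rightarrow> real" where
  "stopped_sum e m x 0 = 0"
| "stopped_sum e m x (Suc k) = stopped_sum e m x k + (if m \<le> k \<and> \<bar>stopped_sum e m x k\<bar> < e then x k else 0)"

text \<open>A value outside \<open>(-e, e)\<close> never changes again, so being inside at time n
  forces all earlier values inside, and no summand from m on was skipped.\<close>

lemma stopped_sum_inside:
  assumes "0 < e" "\<bar>stopped_sum e m x n\<bar> < e"
  shows "stopped_sum e m x n = sum x {m..<n} \<and> (\<forall>k\<le>n. \<bar>sum x {m..<k}\<bar> < e)"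
  using assms(2)
proof (induction n)
  case (Suc n)
  have "\<bar>stopped_sum e m x n\<bar> < e" using Suc.prems by (auto split: if_splits)
  with Suc show ?case by (auto simp: le_Suc_eq)
qed (use assms in simp)

locale bounded_noise = prob_space M for M :: "'a measure" +
  fixes \<eta> :: "nat \<Rightarrow> 'a \<Rightarrow> real"
  assumes indep_\<eta>: "indep_vars (\<lambda>_. borel) \<eta> UNIV"
    and mean_\<eta>: "\<And>i. expectation (\<eta> i) = 0"
    and bounded_\<eta>: "\<And>i. AE \<omega> in M. \<bar>\<eta> i \<omega>\<bar> \<le> 1"
begin

lemma measurable_\<eta> [measurable]: "\<eta> i \<in> borel_measurable M"
  using indep_\<eta> by (auto simp: indep_vars_def)

text \<open>Summands are exchanged for normal ones from the last backwards. The shift s and the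
  variance budget \<open>\<sigma>^2\<close> vary in the induction, since the normal replacement of
  the last summand is absorbed into s.\<close>

lemma gauss_test_partial_sum:
  assumes f: "gauss_test f" and "0 \<le> \<sigma>" "(\<Sum>i<n. (a i)\<^sup>2) \<le> \<sigma>\<^sup>2"
  shows "(\<integral>\<^sup>+\<omega>. ennreal (f (s + (\<Sum>i<n. a i * \<eta> i \<omega>))) \<partial>M) \<le> (\<integral>\<^sup>+t. ennreal (f (s + \<sigma> * t)) \<partial>std_gauss)"
  using assms(2,3)
proof (induction n arbitrary: \<sigma> s)
  case 0
  then show ?case using gauss_test_le_gauss[OF f, of s \<sigma>] by (simp add: emeasure_space_1)
next
  case (Suc n)
  note [measurable] = gauss_test_measurable[OF f]
  \<comment> \<open>\<open>\<tau>^2\<close> is the variance left for the first n summands.\<close>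
  define \<tau> where "\<tau> = sqrt (\<sigma>\<^sup>2 - (a n)\<^sup>2)"
  have nonneg: "0 \<le> (\<Sum>i<n. (a i)\<^sup>2)" by (rule sum_nonneg) simp
  then have \<tau>: "0 \<le> \<tau>" "\<tau>\<^sup>2 = \<sigma>\<^sup>2 - (a n)\<^sup>2" using Suc.prems by (simp_all add: \<tau>_def)
  have ind: "indep_var borel (\<lambda>\<omega>. \<Sum>i<n. a i * \<eta> i \<omega>) borel (\<eta> n)"
    by (rule indep_var_recursion[OF indep_\<eta>, where c = 0 and \<Phi> = "\<lambda>n w x. w + a n * x"]) auto
  let ?S = "\<lambda>\<omega>. \<Sum>i<n. a i * \<eta> i \<omega>"
  let ?D = "distr M borel ?S" and ?E = "distr M borel (\<eta> n)"
  interpret D: prob_space ?D by (rule prob_space_distr) simp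
  interpret E: prob_space ?E by (rule prob_space_distr) simp
  interpret P: pair_sigma_finite ?D std_gauss
    by (intro pair_sigma_finite.intro D.sigma_finite_measure_axioms std_gauss.sigma_finite_measure_axioms)
  have "(\<integral>\<^sup>+\<omega>. ennreal (f (s + (\<Sum>i<Suc n. a i * \<eta> i \<omega>))) \<partial>M)
      = (\<integral>\<^sup>+z. ennreal (f (s + fst z + a n * snd z)) \<partial>distr M (borel \<Otimes>\<^sub>M borel) (\<lambda>\<omega>. (?S \<omega>, \<eta> n \<omega>)))"
    by (subst nn_integral_distr) (auto simp: add.assoc)
  also have "distr M (borel \<Otimes>\<^sub>M borel) (\<lambda>\<omega>. (?S \<omega>, \<eta> n \<omega>)) = ?D \<Otimes>\<^sub>M ?E"
    using ind by (simp add: indep_var_distribution_eq)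
  also have "(\<integral>\<^sup>+z. ennreal (f (s + fst z + a n * snd z)) \<partial>(?D \<Otimes>\<^sub>M ?E))
      = (\<integral>\<^sup>+x. \<integral>\<^sup>+y. ennreal (f (s + x + a n * y)) \<partial>?E \<partial>?D)"
    by (subst E.nn_integral_fst[symmetric]) auto
  also have "\<dots> \<le> (\<integral>\<^sup>+x. \<integral>\<^sup>+t. ennreal (f (s + x + a n * t)) \<partial>std_gauss \<partial>?D)"
    using gauss_test_bounded_rv[OF f measurable_\<eta> mean_\<eta> bounded_\<eta>]
    by (intro nn_integral_mono) (simp add: nn_integral_distr)
  \<comment> \<open>With the normal variable outermost, its value joins the shift in the induction
    hypothesis.\<close>
  also have "\<dots> = (\<integral>\<^sup>+t. \<integral>\<^sup>+x. ennreal (f (s + x + a n * t)) \<partial>?D \<partial>std_gauss)"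
    by (rule P.Fubini'[symmetric]) measurable
  also have "\<dots> = (\<integral>\<^sup>+t. \<integral>\<^sup>+\<omega>. ennreal (f ((s + a n * t) + ?S \<omega>)) \<partial>M \<partial>std_gauss)"
    by (simp add: nn_integral_distr ac_simps)
  also have "\<dots> \<le> (\<integral>\<^sup>+t. \<integral>\<^sup>+r. ennreal (f ((s + a n * t) + \<tau> * r)) \<partial>std_gauss \<partial>std_gauss)"
    using \<tau> Suc.prems by (intro nn_integral_mono Suc.IH) auto
  also have "\<dots> = (\<integral>\<^sup>+t. ennreal (f (s + sqrt ((a n)\<^sup>2 + \<tau>\<^sup>2) * t)) \<partial>std_gauss)"
    using \<tau> by (intro nn_integral_gauss_add) auto
  finally show ?case using \<tau> Suc.prems by simp
qed

text \<open>The cross term in the square of \<open>W (Suc n)\<close> has mean 0, as its factor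
  depends only on the past and \<open>\<eta> n\<close> is centred and independent of it. The squared
  increment is at most \<open>(a n)^2\<close>, and is 0 for \<open>n < m\<close>.\<close>

lemma second_moment_stopped_sum:
  assumes "0 < e"
  shows "integrable M (\<lambda>\<omega>. (stopped_sum e m (\<lambda>i. a i * \<eta> i \<omega>) n)\<^sup>2)"
    and "expectation (\<lambda>\<omega>. (stopped_sum e m (\<lambda>i. a i * \<eta> i \<omega>) n)\<^sup>2) \<le> (\<Sum>i\<in>{m..<n}. (a i)\<^sup>2)"
proof -
  define W where "W n \<omega> = stopped_sum e m (\<lambda>i. a i * \<eta> i \<omega>) n" for n \<omega>
  define g where "g n w = (if m \<le> n \<and> \<bar>w\<bar> < e then 1 else 0 :: real)" for n :: nat and w :: real
  have [measurable]: "g n \<in> borel_measurable borel" for n unfolding g_def by measurable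
  have W_Suc: "W (Suc n) \<omega> = W n \<omega> + g n (W n \<omega>) * (a n * \<eta> n \<omega>)" for n \<omega>
    by (simp add: W_def g_def)
  have W_0: "W 0 \<omega> = 0" for \<omega> by (simp add: W_def)
  have W [measurable]: "W n \<in> borel_measurable M" for n
    by (induction n) (simp_all add: W_0[abs_def] W_Suc[abs_def])
  have ind: "indep_var borel (W n) borel (\<eta> n)" for n
  proof (rule indep_var_recursion[where W = W and X = \<eta> and c = 0 and \<Phi> = "\<lambda>n w x. w + g n w * (a n * x)"])
    show "(\<lambda>(w, x). w + g n w * (a n * x)) \<in> borel_measurable (borel \<Otimes>\<^sub>M borel)" for n
      by measurable
  qed (fact indep_\<eta> W_0 W_Suc)+
  have bound: "AE \<omega> in M. \<bar>W n \<omega>\<bar> \<le> (\<Sum>i<n. \<bar>a i\<bar>)" for n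
  proof (induction n)
    case (Suc n)
    from Suc bounded_\<eta>[of n] show ?case
    proof eventually_elim
      fix \<omega> assume *: "\<bar>W n \<omega>\<bar> \<le> (\<Sum>i<n. \<bar>a i\<bar>)" "\<bar>\<eta> n \<omega>\<bar> \<le> 1"
      have "\<bar>g n (W n \<omega>) * (a n * \<eta> n \<omega>)\<bar> \<le> 1 * (\<bar>a n\<bar> * 1)"
        unfolding abs_mult using * by (intro mult_mono) (auto simp: g_def)
      with * show "\<bar>W (Suc n) \<omega>\<bar> \<le> (\<Sum>i<Suc n. \<bar>a i\<bar>)" by (simp add: W_Suc)
    qed
  qed (simp add: W_0)
  have int\<eta>: "integrable M (\<eta> n)" for n
    by (rule integrable_const_bound[of _ 1]) (use bounded_\<eta> in auto)
  have intW2: "integrable M (\<lambda>\<omega>. (W n \<omega>)\<^sup>2)" for n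
  proof (rule integrable_const_bound[of _ "(\<Sum>i<n. \<bar>a i\<bar>)\<^sup>2"])
    show "AE \<omega> in M. norm ((W n \<omega>)\<^sup>2) \<le> (\<Sum>i<n. \<bar>a i\<bar>)\<^sup>2"
      using bound[of n]
    proof eventually_elim
      fix \<omega> assume "\<bar>W n \<omega>\<bar> \<le> (\<Sum>i<n. \<bar>a i\<bar>)"
      from power_mono[OF this, of 2] show "norm ((W n \<omega>)\<^sup>2) \<le> (\<Sum>i<n. \<bar>a i\<bar>)\<^sup>2" by simp
    qed
  qed measurable
  have "expectation (\<lambda>\<omega>. (W n \<omega>)\<^sup>2) \<le> (\<Sum>i\<in>{m..<n}. (a i)\<^sup>2)" for n
  proof (induction n)
    case (Suc n)
    let ?V = "\<lambda>\<omega>. 2 * a n * (g n (W n \<omega>) * W n \<omega>)"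
    have indV: "indep_var borel ?V borel (\<eta> n)"
    proof -
      have "indep_var borel ((\<lambda>w. 2 * a n * (g n w * w)) \<circ> W n) borel ((\<lambda>x. x) \<circ> \<eta> n)"
        by (rule indep_var_compose[OF ind]) measurable
      then show ?thesis by (simp only: comp_def)
    qed
    \<comment> \<open>Bounded because the stopping indicator \<open>g\<close> vanishes once \<bar>W
      n \<omega>\<bar> reaches e.\<close>
    have intV: "integrable M ?V"
    proof (rule integrable_const_bound[of _ "2 * \<bar>a n\<bar> * e"])
      show "AE \<omega> in M. norm (?V \<omega>) \<le> 2 * \<bar>a n\<bar> * e"
        using \<open>0 < e\<close> by (intro AE_I2) (auto simp: abs_mult g_def intro!: mult_left_mono)
    qed simp
    note intV\<eta> = indep_var_integrable[OF indV intV int\<eta>]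
    define c where "c = (if m \<le> n then (a n)\<^sup>2 else 0)"
    have "expectation (\<lambda>\<omega>. (W (Suc n) \<omega>)\<^sup>2) \<le> expectation (\<lambda>\<omega>. (W n \<omega>)\<^sup>2 + ?V \<omega> * \<eta> n \<omega> + c)"
    proof (rule integral_mono_AE)
      show "AE \<omega> in M. (W (Suc n) \<omega>)\<^sup>2 \<le> (W n \<omega>)\<^sup>2 + ?V \<omega> * \<eta> n \<omega> + c"
        using bounded_\<eta>[of n]
      proof eventually_elim
        fix \<omega> assume "\<bar>\<eta> n \<omega>\<bar> \<le> 1"
        then have "(\<eta> n \<omega>)\<^sup>2 \<le> 1" by (simp add: abs_square_le_1)
        then have "(a n * \<eta> n \<omega>)\<^sup>2 \<le> (a n)\<^sup>2"
          unfolding power_mult_distrib by (intro mult_left_le) auto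
        then have "(g n (W n \<omega>) * (a n * \<eta> n \<omega>))\<^sup>2 \<le> c"
          by (simp add: g_def c_def)
        then show "(W (Suc n) \<omega>)\<^sup>2 \<le> (W n \<omega>)\<^sup>2 + ?V \<omega> * \<eta> n \<omega> + c"
          by (simp add: W_Suc power2_sum)
      qed
    qed (intro intW2 Bochner_Integration.integrable_add intV\<eta> integrable_const)+
    also have "\<dots> = expectation (\<lambda>\<omega>. (W n \<omega>)\<^sup>2) + expectation (\<lambda>\<omega>. ?V \<omega> * \<eta> n \<omega>) + c"
      by (subst Bochner_Integration.integral_add,
          (intro intW2 Bochner_Integration.integrable_add intV\<eta> integrable_const)+)+ (simp add: prob_space)
    also have "expectation (\<lambda>\<omega>. ?V \<omega> * \<eta> n \<omega>) = 0"
      using indep_var_lebesgue_integral[OF indV intV int\<eta>] mean_\<eta> by simp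
    finally show ?case using Suc by (auto simp: c_def)
  qed (simp add: W_0)
  then show "expectation (\<lambda>\<omega>. (stopped_sum e m (\<lambda>i. a i * \<eta> i \<omega>) n)\<^sup>2) \<le> (\<Sum>i\<in>{m..<n}. (a i)\<^sup>2)"
    and "integrable M (\<lambda>\<omega>. (stopped_sum e m (\<lambda>i. a i * \<eta> i \<omega>) n)\<^sup>2)"
    using intW2 by (simp_all add: W_def)
qed

text \<open>If some partial sum reaches e in absolute value, the stopped sum is still at that level
  at time n, so Markov's inequality for a single square controls the maximum over k.\<close>

lemma maximal_inequality:
  assumes e: "0 < e"
  shows "prob {\<omega> \<in> space M. \<exists>k\<le>n. e \<le> \<bar>\<Sum>i\<in>{m..<k}. a i * \<eta> i \<omega>\<bar>} \<le> (\<Sum>i\<in>{m..<n}. (a i)\<^sup>2) / e\<^sup>2"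
proof -
  let ?W = "\<lambda>\<omega>. stopped_sum e m (\<lambda>i. a i * \<eta> i \<omega>) n"
  have [measurable]: "(\<lambda>\<omega>. stopped_sum e m (\<lambda>i. a i * \<eta> i \<omega>) k) \<in> borel_measurable M" for k
    by (induction k) simp_all
  have "prob {\<omega> \<in> space M. \<exists>k\<le>n. e \<le> \<bar>\<Sum>i\<in>{m..<k}. a i * \<eta> i \<omega>\<bar>} \<le> prob {\<omega> \<in> space M. e\<^sup>2 \<le> (?W \<omega>)\<^sup>2}"
  proof (intro finite_measure_mono subsetI)
    fix \<omega> assume *: "\<omega> \<in> {\<omega> \<in> space M. \<exists>k\<le>n. e \<le> \<bar>\<Sum>i\<in>{m..<k}. a i * \<eta> i \<omega>\<bar>}"
    then have "e \<le> \<bar>?W \<omega>\<bar>"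
      using stopped_sum_inside[OF e, of m "\<lambda>i. a i * \<eta> i \<omega>" n] by force
    then have "e\<^sup>2 \<le> \<bar>?W \<omega>\<bar>\<^sup>2" using e by (intro power_mono) auto
    then show "\<omega> \<in> {\<omega> \<in> space M. e\<^sup>2 \<le> (?W \<omega>)\<^sup>2}" using * by simp
  qed measurable
  also have "\<dots> \<le> expectation (\<lambda>\<omega>. (?W \<omega>)\<^sup>2) / e\<^sup>2"
    using second_moment_stopped_sum(1)[OF e] e by (intro integral_Markov_inequality_measure[where A = "{}"]) auto
  also have "\<dots> \<le> (\<Sum>i\<in>{m..<n}. (a i)\<^sup>2) / e\<^sup>2"
    using second_moment_stopped_sum(2)[OF e] by (intro divide_right_mono) auto
  finally show ?thesis .
qed

text \<open>Letting n grow in \<open>maximal_inequality\<close> bounds the probability of ever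
  reaching e from m on by a tail of the series of squares over \<open>e^2\<close>. These bounds tend
  to 0, so reaching e for every m has probability 0.\<close>

lemma AE_small_tail:
  assumes sq: "summable (\<lambda>i. (a i)\<^sup>2)" and e: "0 < e"
  shows "AE \<omega> in M. \<exists>m. \<forall>k. \<bar>\<Sum>i\<in>{m..<k}. a i * \<eta> i \<omega>\<bar> < e"
proof -
  let ?A = "\<lambda>m n. {\<omega> \<in> space M. \<exists>k\<le>n. e \<le> \<bar>\<Sum>i\<in>{m..<k}. a i * \<eta> i \<omega>\<bar>}"
  let ?D = "\<lambda>m. {\<omega> \<in> space M. \<exists>k. e \<le> \<bar>\<Sum>i\<in>{m..<k}. a i * \<eta> i \<omega>\<bar>}"
  let ?T = "\<lambda>m. (\<Sum>i. (a (i + m))\<^sup>2)"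
  have D: "prob (?D m) \<le> ?T m / e\<^sup>2" for m
  proof (rule LIMSEQ_le_const2)
    have "(\<lambda>n. prob (?A m n)) \<longlonglongrightarrow> prob (\<Union>n. ?A m n)"
      by (intro finite_Lim_measure_incseq) (auto simp: incseq_def intro: order_trans)
    also have "(\<Union>n. ?A m n) = ?D m" by auto
    finally show "(\<lambda>n. prob (?A m n)) \<longlonglongrightarrow> prob (?D m)" .
    have "prob (?A m n) \<le> ?T m / e\<^sup>2" for n
    proof -
      have "(\<Sum>i\<in>{m..<n}. (a i)\<^sup>2) \<le> ?T m"
      proof (cases "m \<le> n")
        case True
        have "(\<Sum>i\<in>{m..<n}. (a i)\<^sup>2) = (\<Sum>i<n-m. (a (i + m))\<^sup>2)"
          using True by (intro sum.reindex_bij_witness[of _ "\<lambda>i. i + m" "\<lambda>i. i - m"]) auto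
        also have "\<dots> \<le> ?T m"
          using sq by (intro sum_le_suminf summable_ignore_initial_segment) auto
        finally show ?thesis .
      next
        case False
        have "0 \<le> ?T m" using sq by (intro suminf_nonneg summable_ignore_initial_segment) auto
        with False show ?thesis by simp
      qed
      then have "(\<Sum>i\<in>{m..<n}. (a i)\<^sup>2) / e\<^sup>2 \<le> ?T m / e\<^sup>2" by (intro divide_right_mono) auto
      with maximal_inequality[OF e, where n = n and m = m and a = a] show ?thesis by linarith
    qed
    then show "\<exists>N. \<forall>n\<ge>N. prob (?A m n) \<le> ?T m / e\<^sup>2" by (intro exI allI impI)
  qed
  have "prob (\<Inter>m. ?D m) \<le> 0"
  proof (rule LIMSEQ_le_const)
    show "(\<lambda>m. ?T m / e\<^sup>2) \<longlonglongrightarrow> 0"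
      using tendsto_divide[OF suminf_exist_split2[OF sq] tendsto_const, of "e\<^sup>2"] e by simp
    have "prob (\<Inter>m. ?D m) \<le> ?T m / e\<^sup>2" for m
    proof (rule order_trans[OF _ D])
      show "prob (\<Inter>m. ?D m) \<le> prob (?D m)"
        by (rule finite_measure_mono) (blast, measurable)
    qed
    then show "\<exists>N. \<forall>m\<ge>N. prob (\<Inter>m. ?D m) \<le> ?T m / e\<^sup>2" by (intro exI allI impI)
  qed
  then have "prob (\<Inter>m. ?D m) = 0" by (simp add: measure_le_0_iff)
  then have "(\<Inter>m. ?D m) \<in> null_sets M"
    by (simp add: null_sets_def emeasure_eq_measure)
  then show ?thesis by (rule AE_I') (auto simp: not_less)
qed

lemma AE_summable:
  assumes sq: "summable (\<lambda>i. (a i)\<^sup>2)"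
  shows "AE \<omega> in M. summable (\<lambda>i. a i * \<eta> i \<omega>)"
proof -
  have "AE \<omega> in M. \<forall>j. \<exists>m. \<forall>k. \<bar>\<Sum>i\<in>{m..<k}. a i * \<eta> i \<omega>\<bar> < 1 / real (Suc j)"
    unfolding AE_all_countable using sq by (intro allI AE_small_tail) auto
  then show ?thesis
  proof eventually_elim
    fix \<omega> assume *: "\<forall>j. \<exists>m. \<forall>k. \<bar>\<Sum>i\<in>{m..<k}. a i * \<eta> i \<omega>\<bar> < 1 / real (Suc j)"
    show "summable (\<lambda>i. a i * \<eta> i \<omega>)"
      unfolding summable_Cauchy
    proof (intro allI impI)
      fix e :: real assume "0 < e"
      \<comment> \<open>Half of e, since a block from m to n is the difference of two blocks
        starting at N.\<close>
      then obtain j where j: "1 / real (Suc j) < e / 2" using nat_approx_posE[of "e / 2"] by auto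
      obtain N where N: "\<And>k. \<bar>\<Sum>i\<in>{N..<k}. a i * \<eta> i \<omega>\<bar> < 1 / real (Suc j)" using * by blast
      have "norm (\<Sum>i\<in>{m..<n}. a i * \<eta> i \<omega>) < e" if "N \<le> m" for m n
      proof (cases "m \<le> n")
        case True
        then have "(\<Sum>i\<in>{m..<n}. a i * \<eta> i \<omega>) = (\<Sum>i\<in>{N..<n}. a i * \<eta> i \<omega>) - (\<Sum>i\<in>{N..<m}. a i * \<eta> i \<omega>)"
          using sum.atLeastLessThan_concat[OF that True, of "\<lambda>i. a i * \<eta> i \<omega>"] by simp
        then show ?thesis using N[of n] N[of m] j by (simp add: real_norm_def)
      qed (use \<open>0 < e\<close> in simp)
      then show "\<exists>N. \<forall>m\<ge>N. \<forall>n. norm (\<Sum>i\<in>{m..<n}. a i * \<eta> i \<omega>) < e" by blast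
    qed
  qed
qed

end

section \<open>Tail bounds\<close>

text \<open>Convergence is asked for almost everywhere only, so the locale also accepts the
  coefficients \<open>- a i\<close> with the sum \<open>- S\<close>, which supplies the lower
  tail.\<close>

locale normalized_series = bounded_noise +
  fixes a :: "nat \<Rightarrow> real" and S :: "'a \<Rightarrow> real"
  assumes sq_sums: "(\<lambda>i. (a i)\<^sup>2) sums 1"
    and S_measurable [measurable]: "S \<in> borel_measurable M"
    and AE_S: "AE \<omega> in M. (\<lambda>i. a i * \<eta> i \<omega>) sums S \<omega>"
begin

lemma gauss_test_series:
  assumes f: "gauss_test f"
  shows "(\<integral>\<^sup>+\<omega>. ennreal (f (s + S \<omega>)) \<partial>M) \<le> (\<integral>\<^sup>+t. ennreal (f (s + t)) \<partial>std_gauss)"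
proof -
  note [measurable] = gauss_test_measurable[OF f]
  have cont: "isCont f y" for y
    using f convex_on_continuous[of UNIV f] by (auto simp: gauss_test_def continuous_on_eq_continuous_at)
  let ?u = "\<lambda>n \<omega>. ennreal (f (s + (\<Sum>i<n. a i * \<eta> i \<omega>)))"
  have "(\<integral>\<^sup>+\<omega>. ennreal (f (s + S \<omega>)) \<partial>M) = (\<integral>\<^sup>+\<omega>. liminf (\<lambda>n. ?u n \<omega>) \<partial>M)"
  proof (rule nn_integral_cong_AE)
    show "AE \<omega> in M. ennreal (f (s + S \<omega>)) = liminf (\<lambda>n. ?u n \<omega>)"
      using AE_S
    proof eventually_elim
      fix \<omega> assume "(\<lambda>i. a i * \<eta> i \<omega>) sums S \<omega>"
      then have "(\<lambda>n. s + (\<Sum>i<n. a i * \<eta> i \<omega>)) \<longlonglongrightarrow> s + S \<omega>"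
        unfolding sums_def by (intro tendsto_intros)
      then have "(\<lambda>n. ?u n \<omega>) \<longlonglongrightarrow> ennreal (f (s + S \<omega>))"
        by (intro tendsto_ennrealI isCont_tendsto_compose[OF cont])
      then show "ennreal (f (s + S \<omega>)) = liminf (\<lambda>n. ?u n \<omega>)"
        by (simp add: lim_imp_Liminf)
    qed
  qed
  also have "\<dots> \<le> liminf (\<lambda>n. \<integral>\<^sup>+\<omega>. ?u n \<omega> \<partial>M)"
    by (rule nn_integral_liminf) measurable
  also have "\<dots> \<le> liminf (\<lambda>n. \<integral>\<^sup>+t. ennreal (f (s + t)) \<partial>std_gauss)"
  proof (intro Liminf_mono always_eventually allI)
    fix n
    have "(\<Sum>i<n. (a i)\<^sup>2) \<le> 1\<^sup>2"
      using sum_le_suminf[OF sums_summable[OF sq_sums], of "{..<n}"] sums_unique[OF sq_sums] by simp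
    from gauss_test_partial_sum[OF f _ this, of s]
    show "(\<integral>\<^sup>+\<omega>. ?u n \<omega> \<partial>M) \<le> (\<integral>\<^sup>+t. ennreal (f (s + t)) \<partial>std_gauss)" by simp
  qed
  also have "\<dots> = (\<integral>\<^sup>+t. ennreal (f (s + t)) \<partial>std_gauss)"
    by (simp add: Liminf_const)
  finally show ?thesis .
qed

text \<open>Markov's inequality for \<open>f (s + S \<omega>)\<close>; a general event P serves
  one-sided and two-sided bounds.\<close>

lemma prob_le_of_gauss_test:
  assumes f: "gauss_test f" and le: "(\<integral>\<^sup>+t. ennreal (f (s + t)) \<partial>std_gauss) \<le> ennreal B"
    and "0 \<le> B" "0 < c" and P: "\<And>\<omega>. P \<omega> \<Longrightarrow> c \<le> f (s + S \<omega>)"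
    and [measurable]: "Measurable.pred M P"
  shows "\<P>(\<omega> in M. P \<omega>) \<le> B / c"
proof -
  note [measurable] = gauss_test_measurable[OF f]
  let ?A = "{\<omega> \<in> space M. P \<omega>}"
  have "ennreal c * emeasure M ?A = (\<integral>\<^sup>+\<omega>. ennreal c * indicator ?A \<omega> \<partial>M)"
    by (simp add: nn_integral_cmult)
  also have "\<dots> \<le> (\<integral>\<^sup>+\<omega>. ennreal (f (s + S \<omega>)) \<partial>M)"
    using P by (intro nn_integral_mono) (auto split: split_indicator intro!: ennreal_leI)
  also have "\<dots> \<le> ennreal B" using gauss_test_series[OF f] le by (rule order_trans)
  finally have "c * prob ?A \<le> B"
    using \<open>0 < c\<close> \<open>0 \<le> B\<close> by (simp add: emeasure_eq_measure ennreal_mult[symmetric])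
  then show ?thesis using \<open>0 < c\<close> by (simp add: field_simps)
qed

lemma prob_ge_le_exp:
  assumes x: "0 < x"
  shows "\<P>(\<omega> in M. x \<le> S \<omega>) \<le> exp (- x\<^sup>2 / 2)"
proof -
  have "\<P>(\<omega> in M. x \<le> S \<omega>) \<le> ((3 / x)^3 * exp (- x\<^sup>2 / 2)) / (3 / x)^3"
  proof (rule prob_le_of_gauss_test[OF gauss_test_cube, where s = "- (x - 3 / x)"])
    show "(\<integral>\<^sup>+t. ennreal ((max 0 (- (x - 3 / x) + t))^3) \<partial>std_gauss) \<le> ennreal ((3 / x)^3 * exp (- x\<^sup>2 / 2))"
      using nn_integral_gauss_cube_le_exp[OF x] by (simp add: algebra_simps)
    show "(3 / x)^3 \<le> (max 0 (- (x - 3 / x) + S \<omega>))^3" if "x \<le> S \<omega>" for \<omega>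
      using that x by (intro power_mono) auto
  qed (use x in auto)
  then show ?thesis using x by simp
qed

text \<open>The distance \<open>x - u = 3 / k\<close> minimizes
  \<open>exp (k * (x - u)) / (x - u)^3\<close>; the resulting factor \<open>6 * exp 3 / 27\<close>
  is \<open>exp lam\<close>.\<close>

lemma prob_ge_le_gauss_tail:
  "\<P>(\<omega> in M. x \<le> S \<omega>) \<le> exp lam * gauss_tail x"
proof -
  define k where "k = std_normal_density x / gauss_tail x"
  have k: "0 < k" by (simp add: k_def gauss_tail_pos)
  have "\<P>(\<omega> in M. x \<le> S \<omega>) \<le> (gauss_tail x * exp (k * (x - (x - 3 / k))) * (6 / k^3)) / (3 / k)^3"
  proof (rule prob_le_of_gauss_test[OF gauss_test_cube, where s = "- (x - 3 / k)"])
    show "(\<integral>\<^sup>+t. ennreal ((max 0 (- (x - 3 / k) + t))^3) \<partial>std_gauss)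
        \<le> ennreal (gauss_tail x * exp (k * (x - (x - 3 / k))) * (6 / k^3))"
      using nn_integral_gauss_cube_le[of "x - 3 / k" x] by (simp only: k_def[symmetric] uminus_add_conv_diff)
    show "(3 / k)^3 \<le> (max 0 (- (x - 3 / k) + S \<omega>))^3" if "x \<le> S \<omega>" for \<omega>
      using that k by (intro power_mono) auto
  qed (use k gauss_tail_nonneg in auto)
  also have "\<dots> = exp (of_nat 3 * 1) * (2 / 9) * gauss_tail x"
    using k by (simp add: field_simps)
  also have "\<dots> = exp lam * gauss_tail x"
    unfolding exp_of_nat_mult by (simp add: exp_lam)
  finally show ?thesis .
qed

text \<open>The shift \<open>s = 1 / x\<close> minimizes the Markov bound
  \<open>(1 + s^2) / (s + x)^2\<close> over positive s.\<close>

lemma cantelli: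
  assumes x: "0 < x"
  shows "\<P>(\<omega> in M. x \<le> S \<omega>) \<le> 1 / (1 + x\<^sup>2)"
proof -
  have "\<P>(\<omega> in M. x \<le> S \<omega>) \<le> (1 + (1 / x)\<^sup>2) / (1 / x + x)\<^sup>2"
  proof (rule prob_le_of_gauss_test[OF gauss_test_square, where s = "1 / x"])
    show "(1 / x + x)\<^sup>2 \<le> (1 / x + S \<omega>)\<^sup>2" if "x \<le> S \<omega>" for \<omega>
      using that x by (intro power_mono) auto
    have "0 < 1 / x + x" using x by (simp add: add_pos_pos)
    then show "0 < (1 / x + x)\<^sup>2" by simp
  qed (auto simp: nn_integral_gauss_square)
  also have "\<dots> = 1 / (1 + x\<^sup>2)"
  proof -
    have "1 / x + x = (1 + x\<^sup>2) / x" "1 + (1 / x)\<^sup>2 = (1 + x\<^sup>2) / x\<^sup>2"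
      using x by (simp_all add: field_simps power2_eq_square)
    moreover have "1 + x\<^sup>2 \<noteq> 0" using sum_power2_gt_zero_iff[of 1 x] by simp
    ultimately show ?thesis using x by (simp add: power_divide power2_eq_square)
  qed
  finally show ?thesis .
qed

lemma chebyshev:
  assumes x: "0 < x"
  shows "\<P>(\<omega> in M. x \<le> \<bar>S \<omega>\<bar>) \<le> 1 / x\<^sup>2"
proof (rule prob_le_of_gauss_test[OF gauss_test_square, where s = 0])
  show "x\<^sup>2 \<le> (0 + S \<omega>)\<^sup>2" if "x \<le> \<bar>S \<omega>\<bar>" for \<omega>
    using power_mono[OF that, of 2] x by simp
qed (use x nn_integral_gauss_square[of 0] in auto)

lemma prob_ge_le_shifted_gauss_tail:
  assumes x: "0 < x"
  shows "\<P>(\<omega> in M. x \<le> S \<omega>) \<le> gauss_tail (x - lam / x)"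
proof (cases "x \<le> sqrt lam")
  case True
  from cantelli[OF x] cantelli_le_gauss_tail[OF x True] show ?thesis by (rule order_trans)
next
  case False
  then have "sqrt lam \<le> x" by simp
  from prob_ge_le_gauss_tail gauss_tail_shift[OF this] show ?thesis by (rule order_trans)
qed

end

theorem theorem1:
  fixes M :: "'a measure" and N :: "'b measure"
    and \<eta> :: "nat \<Rightarrow> 'a \<Rightarrow> real" and a :: "nat \<Rightarrow> real"
    and S :: "'a \<Rightarrow> real" and Z :: "'b \<Rightarrow> real" and x :: real
  assumes "prob_space M"
    and "prob_space.indep_vars M (\<lambda>_. borel) \<eta> UNIV"
    and "\<And>i. prob_space.expectation M (\<eta> i) = 0"
    and "\<And>i. AE \<omega> in M. \<bar>\<eta> i \<omega>\<bar> \<le> 1"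
    and "(\<lambda>i. (a i)\<^sup>2) sums 1"
    and "S = (\<lambda>\<omega>. \<Sum>i. a i * \<eta> i \<omega>)"
    and "prob_space N"
    and "distributed N lborel Z std_normal_density"
    and "x > 0"
  shows "\<P>(\<omega> in M. S \<omega> \<ge> x)
           \<le> min (exp (- (x\<^sup>2) / 2)) (\<P>(\<omega> in N. Z \<omega> \<ge> x - lam / x))
       \<and> \<P>(\<omega> in M. \<bar>S \<omega>\<bar> \<ge> x)
           \<le> min (1 / x\<^sup>2) (\<P>(\<omega> in N. \<bar>Z \<omega>\<bar> \<ge> x - lam / x))"
proof -
  interpret prob_space M by fact
  interpret N: prob_space N by fact
  interpret bounded_noise M \<eta>
    by unfold_locales (use assms(2-4) in auto)
  have S_meas: "S \<in> borel_measurable M" unfolding assms(6) by measurable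
  \<comment> \<open>\<open>suminf\<close> is the limit only where the series converges, which is
    almost everywhere.\<close>
  have S_sums: "AE \<omega> in M. (\<lambda>i. a i * \<eta> i \<omega>) sums S \<omega>"
    using AE_summable[OF sums_summable[OF assms(5)]]
    by eventually_elim (simp add: assms(6) summable_sums)
  interpret S: normalized_series M \<eta> a S
    by unfold_locales (fact assms(5) S_meas S_sums)+
  \<comment> \<open>The bounds for \<open>- S\<close> control the event
    \<open>S \<omega> \<le> - x\<close>.\<close>
  interpret neg: normalized_series M \<eta> "\<lambda>i. - a i" "\<lambda>\<omega>. - S \<omega>"
  proof
    show "AE \<omega> in M. (\<lambda>i. - a i * \<eta> i \<omega>) sums (- S \<omega>)"
      using S_sums by eventually_elim (use sums_minus in fastforce)
  qed (use assms(5) S_meas in auto)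
  let ?y = "x - lam / x"
  have Z_meas [measurable]: "Z \<in> borel_measurable N"
    using distributed_measurable[OF assms(8)] by simp
  have Z_prob: "\<P>(\<omega> in N. Z \<omega> \<in> A) = measure std_gauss A" if "A \<in> sets borel" for A
  proof -
    have "measure std_gauss A = measure (distr N lborel Z) A"
      using distributed_distr_eq_density[OF assms(8)] by simp
    also have "\<dots> = \<P>(\<omega> in N. Z \<omega> \<in> A)"
      using that distributed_measurable[OF assms(8)]
      by (subst measure_distr) (auto intro!: arg_cong[where f = "measure N"])
    finally show ?thesis ..
  qed
  have tail: "\<P>(\<omega> in N. Z \<omega> \<ge> y) = gauss_tail y" for y
    using Z_prob[of "{y..}"] by (simp add: gauss_tail_def)
  have two_sided: "\<P>(\<omega> in M. \<bar>S \<omega>\<bar> \<ge> x) \<le> \<P>(\<omega> in N. \<bar>Z \<omega>\<bar> \<ge> ?y)"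
  proof (cases "?y \<le> 0")
    case True
    then have "{\<omega> \<in> space N. \<bar>Z \<omega>\<bar> \<ge> ?y} = space N" by auto
    then show ?thesis using N.prob_space by simp
  next
    case False
    have "\<P>(\<omega> in M. \<bar>S \<omega>\<bar> \<ge> x) \<le> measure M ({\<omega> \<in> space M. x \<le> S \<omega>} \<union> {\<omega> \<in> space M. x \<le> - S \<omega>})"
      using S_meas by (intro finite_measure_mono) auto
    also have "\<dots> \<le> \<P>(\<omega> in M. x \<le> S \<omega>) + \<P>(\<omega> in M. x \<le> - S \<omega>)"
      using S_meas by (intro measure_Un_le) auto
    also have "\<dots> \<le> gauss_tail ?y + gauss_tail ?y"
      by (intro add_mono S.prob_ge_le_shifted_gauss_tail neg.prob_ge_le_shifted_gauss_tail assms(9))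
    also have "\<dots> = measure std_gauss {?y..} + measure std_gauss {..- ?y}"
    proof -
      have "gauss_tail ?y = measure (distr std_gauss borel uminus) {?y..}"
        by (simp only: distr_std_gauss_uminus gauss_tail_def)
      also have "\<dots> = measure std_gauss {..- ?y}"
        by (subst measure_distr) (auto intro!: arg_cong[where f = "measure _"])
      finally show ?thesis by (simp add: gauss_tail_def)
    qed
    \<comment> \<open>For positive \<open>?y\<close> the half-lines are disjoint, so the two tails
      add up exactly to a probability for \<bar>Z\<bar>.\<close>
    also have "\<dots> = measure std_gauss ({?y..} \<union> {..- ?y})"
      using False by (intro std_gauss.finite_measure_Union[symmetric]) auto
    also have "\<dots> = \<P>(\<omega> in N. Z \<omega> \<in> {?y..} \<union> {..- ?y})"
      by (rule Z_prob[symmetric]) simp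
    also have "{\<omega> \<in> space N. Z \<omega> \<in> {?y..} \<union> {..- ?y}} = {\<omega> \<in> space N. \<bar>Z \<omega>\<bar> \<ge> ?y}"
      by auto
    finally show ?thesis .
  qed
  show ?thesis
    using S.prob_ge_le_exp[OF assms(9)] S.prob_ge_le_shifted_gauss_tail[OF assms(9)]
      S.chebyshev[OF assms(9)] two_sided by (simp add: tail)
qed

end
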